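(* Let $\tau(n)$ be the number of spanning trees in the graph $\mathcal{D}_{n}=Cay(\mathbb{D}_n,b^{\pm\beta_1},\ldots,b^{\pm\beta_s},ab^{\gamma_1},\ldots,ab^{\gamma_t})$. Then $F(x)=\sum_{n=1}^\infty\tau(n)x^n$ is a rational function with integer coefficients. Moreover, $F(\eta\,x)=F\left(\frac{1}{\eta\, x}\right)$, where $\eta$ is the leading coefficient of the associated polynomial $P(z)$. The latter allows one to represent $F(x)$ as a rational function of $u=\frac12\left(\eta\, x+\frac1{\eta\, x}\right)$.
   Context: Let $s\ge 0$, $t\ge 1$ be fixed integers and let $0<\beta_1<\cdots<\beta_s$ and $0\le\gamma_1<\cdots<\gamma_t$ be fixed integers. Let $\mathbb{D}_n=\langle a,b\mid a^2=1,\ b^n=1,\ (ab)^2=1\rangle$ be the dihedral group of order $2n$ and $\mathcal{D}_n=Cay(\mathbb{D}_n,b^{\pm\beta_1},\ldots,b^{\pm\beta_s},ab^{\gamma_1},\ldots,ab^{\gamma_t})$ the Cayley graph. When $\beta_s<\frac n2$ (if $s\ge1$) and $\gamma_t\le n-1$, this is the simple undirected graph with vertex set $\mathbb{D}_n$ in which $g,h$ are adjacent iff $h=gx$ for some $x\in S=\{b^{\pm\beta_1},\ldots,b^{\pm\beta_s},ab^{\gamma_1},\ldots,ab^{\gamma_t}\}$. For arbitrary $n\ge1$ it is understood as the multigraph with vertices $b^k$ and $b^ka$ ($k\in\mathbb{Z}/n\mathbb{Z}$) having, for each $k\in\mathbb{Z}/n\mathbb{Z}$ and each $i\in\{1,\dots,s\}$,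 one edge joining $b^k$ and $b^{k+\beta_i}$ and one edge joining $b^ka$ and $b^{k+\beta_i}a$, and, for each $k\in\mathbb{Z}/n\mathbb{Z}$ and each $j\in\{1,\dots,t\}$, one edge joining $b^k$ and $b^{k-\gamma_j}a$ (edges counted with multiplicity; loops never belong to a spanning tree; $\tau(n)=0$ if the multigraph is disconnected). The two descriptions agree when both apply. The associated Laurent polynomial is $P(z)=\mathcal{A}(z)\mathcal{A}(z^{-1})-\mathcal{B}(z)\mathcal{B}(z^{-1})$, where $\mathcal{A}(z)=2s+t-\sum_{i=1}^{s}(z^{\beta_i}+z^{-\beta_i})$ and $\mathcal{B}(z)=-\sum_{i=1}^{t}z^{\gamma_i}$. Its leading coefficient $\eta$ is the coefficient of the highest power of $z$ occurring in $P$.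
   Formalization: The printed identity F(ηx)=F(1/(ηx)) fails when |η|≠1 (e.g. s=1, β=1, t=2, γ=(0,2), η=-8); it is replaced by F(x/η)=F(1/(ηx)), the same when η=±1. The symmetry and the form in u are stated for P≠0, since η is undefined when P=0 (s=0, t=1). *)

theory Defs
  imports
    Complex_Main
    "HOL-Library.Poly_Mapping"
    "HOL-Computational_Algebra.Computational_Algebra"
begin

section \<open>Spanning trees of finite undirected multigraphs\<close>

text \<open>
  A multigraph is given by a vertex set \<open>V\<close>, a set \<open>E\<close> of (names of) edges and a function \<open>ends\<close>
  giving the set of endpoints of an edge: two vertices, or one in the case of a loop. Parallel
  edges are different names with the same endpoints. Subgraphs containing all the vertices are
  identified with their edge sets.
\<close>

definition mg_connected :: "'v set \<Rightarrow> ('e \<Rightarrow> 'v set) \<Rightarrow> 'e set \<Rightarrow> bool" where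
  "mg_connected V ends T \<longleftrightarrow>
     V \<noteq> {} \<and> (\<forall>u\<in>V. \<forall>v\<in>V. (u, v) \<in> {(x, y). \<exists>e\<in>T. ends e = {x, y}}\<^sup>*)"

text \<open>
  The cycle \<open>vs ! 0, es ! 0, vs ! 1, es ! 1, \<dots>, es ! (length vs - 1), vs ! 0\<close>. Length 1 is a loop
  and length 2 is a pair of parallel edges.
\<close>

definition mg_cycle :: "('e \<Rightarrow> 'v set) \<Rightarrow> 'e set \<Rightarrow> 'v list \<Rightarrow> 'e list \<Rightarrow> bool" where
  "mg_cycle ends T vs es \<longleftrightarrow>
     es \<noteq> [] \<and> length vs = length es \<and> distinct vs \<and> distinct es \<and> set es \<subseteq> T \<and>
     (\<forall>i<length es. ends (es ! i) = {vs ! i, vs ! (Suc i mod length es)})"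

definition mg_acyclic :: "('e \<Rightarrow> 'v set) \<Rightarrow> 'e set \<Rightarrow> bool" where
  "mg_acyclic ends T \<longleftrightarrow> \<not> (\<exists>vs es. mg_cycle ends T vs es)"

definition spanning_trees :: "'v set \<Rightarrow> 'e set \<Rightarrow> ('e \<Rightarrow> 'v set) \<Rightarrow> 'e set set" where
  "spanning_trees V E ends = {T. T \<subseteq> E \<and> mg_connected V ends T \<and> mg_acyclic ends T}"

section \<open>The Cayley graph of the dihedral group\<close>

text \<open>
  For \<open>0 \<le> k < n\<close>, \<open>Rot k\<close> is the group element \<open>b^k\<close> and \<open>Refl k\<close> is \<open>b^k a\<close>.
  The generator \<open>b^(\<beta> i)\<close> and its inverse give one edge \<open>RotEdge k i\<close> from \<open>b^k\<close> to \<open>b^(k + \<beta> i)\<close> and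
  one edge \<open>ReflEdge k i\<close> from \<open>b^k a\<close> to \<open>b^(k + \<beta> i) a = (b^k a) b^(- \<beta> i)\<close>. The
  involution \<open>a b^(\<gamma> j)\<close> gives the edge \<open>CrossEdge k j\<close>, as \<open>b^k (a b^(\<gamma> j)) = b^(k - \<gamma> j) a\<close>.
\<close>

datatype dihedral_vertex = Rot int | Refl int

datatype dihedral_edge = RotEdge int nat | ReflEdge int nat | CrossEdge int nat

definition dihedral_verts :: "nat \<Rightarrow> dihedral_vertex set" where
  "dihedral_verts n = Rot ` {0..<int n} \<union> Refl ` {0..<int n}"

definition dihedral_edges :: "nat \<Rightarrow> nat \<Rightarrow> nat \<Rightarrow> dihedral_edge set" where
  "dihedral_edges s t n =
     {RotEdge k i | k i. k \<in> {0..<int n} \<and> i \<in> {1..s}} \<union>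
     {ReflEdge k i | k i. k \<in> {0..<int n} \<and> i \<in> {1..s}} \<union>
     {CrossEdge k j | k j. k \<in> {0..<int n} \<and> j \<in> {1..t}}"

fun dihedral_ends ::
  "(nat \<Rightarrow> int) \<Rightarrow> (nat \<Rightarrow> int) \<Rightarrow> nat \<Rightarrow> dihedral_edge \<Rightarrow> dihedral_vertex set" where
  "dihedral_ends \<beta> \<gamma> n (RotEdge k i) = {Rot k, Rot ((k + \<beta> i) mod int n)}"
| "dihedral_ends \<beta> \<gamma> n (ReflEdge k i) = {Refl k, Refl ((k + \<beta> i) mod int n)}"
| "dihedral_ends \<beta> \<gamma> n (CrossEdge k j) = {Rot k, Refl ((k - \<gamma> j) mod int n)}"

definition dihedral_tau ::
  "nat \<Rightarrow> nat \<Rightarrow> (nat \<Rightarrow> int) \<Rightarrow> (nat \<Rightarrow> int) \<Rightarrow> nat \<Rightarrow> nat" where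
  "dihedral_tau s t \<beta> \<gamma> n =
     card (spanning_trees (dihedral_verts n) (dihedral_edges s t n) (dihedral_ends \<beta> \<gamma> n))"

definition dihedral_tau_gf ::
  "nat \<Rightarrow> nat \<Rightarrow> (nat \<Rightarrow> int) \<Rightarrow> (nat \<Rightarrow> int) \<Rightarrow> int fps" where
  "dihedral_tau_gf s t \<beta> \<gamma> =
     Abs_fps (\<lambda>n. if n = 0 then 0 else int (dihedral_tau s t \<beta> \<gamma> n))"

section \<open>The associated Laurent polynomial\<close>

text \<open>
  The convolution ring \<open>int \<Rightarrow>\<^sub>0 int\<close> is the ring of Laurent polynomials with integer coefficients:
  \<open>Poly_Mapping.single k c\<close> is \<open>c z^k\<close>.
\<close>

type_synonym laurent_poly = "int \<Rightarrow>\<^sub>0 int"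

definition laurent_inv :: "laurent_poly \<Rightarrow> laurent_poly" where \<comment> \<open>substitution of \<open>z\<^sup>-\<^sup>1\<close> for \<open>z\<close>\<close>
  "laurent_inv p = Poly_Mapping.map_key uminus p"

definition laurent_lead :: "laurent_poly \<Rightarrow> int" where \<comment> \<open>meaningful for nonzero arguments only\<close>
  "laurent_lead p = Poly_Mapping.lookup p (Max (Poly_Mapping.keys p))"

definition dihedral_A :: "nat \<Rightarrow> nat \<Rightarrow> (nat \<Rightarrow> int) \<Rightarrow> laurent_poly" where
  "dihedral_A s t \<beta> =
     Poly_Mapping.single 0 (2 * int s + int t) -
     (\<Sum>i=1..s. Poly_Mapping.single (\<beta> i) 1 + Poly_Mapping.single (- \<beta> i) 1)"

definition dihedral_B :: "nat \<Rightarrow> (nat \<Rightarrow> int) \<Rightarrow> laurent_poly" where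
  "dihedral_B t \<gamma> = - (\<Sum>i=1..t. Poly_Mapping.single (\<gamma> i) 1)"

definition dihedral_P ::
  "nat \<Rightarrow> nat \<Rightarrow> (nat \<Rightarrow> int) \<Rightarrow> (nat \<Rightarrow> int) \<Rightarrow> laurent_poly" where
  "dihedral_P s t \<beta> \<gamma> =
     dihedral_A s t \<beta> * laurent_inv (dihedral_A s t \<beta>) -
     dihedral_B t \<gamma> * laurent_inv (dihedral_B t \<gamma>)"

definition dihedral_eta ::
  "nat \<Rightarrow> nat \<Rightarrow> (nat \<Rightarrow> int) \<Rightarrow> (nat \<Rightarrow> int) \<Rightarrow> int" where
  "dihedral_eta s t \<beta> \<gamma> = laurent_lead (dihedral_P s t \<beta> \<gamma>)"

section \<open>Rational functions with integer coefficients\<close>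

text \<open>
  The rational function \<open>p / q\<close> is represented by its numerator and denominator. Identities between
  rational functions are stated pointwise at the complex numbers where no denominator vanishes,
  which are all but finitely many.
\<close>

definition ratfun_defined :: "int poly \<Rightarrow> complex \<Rightarrow> bool" where
  "ratfun_defined q x \<longleftrightarrow> poly (map_poly of_int q) x \<noteq> 0"

definition ratfun_eval :: "int poly \<Rightarrow> int poly \<Rightarrow> complex \<Rightarrow> complex" where
  "ratfun_eval p q x = poly (map_poly of_int p) x / poly (map_poly of_int q) x"

definition fps_is_ratfun :: "int fps \<Rightarrow> int poly \<Rightarrow> int poly \<Rightarrow> bool" where
  "fps_is_ratfun F p q \<longleftrightarrow> q \<noteq> 0 \<and> fps_of_poly q * F = fps_of_poly p"

end

theory Submission
  imports Defs "Jordan_Normal_Form.Determinant"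
begin

text \<open>
  Let \<open>L\<close> be the Laplacian of the multigraph, a matrix of size \<open>2 n\<close>. The coefficient of \<open>x\<close> in
  \<open>det (x I + L)\<close> is \<open>2 n \<tau>(n)\<close> (\<open>matrix_tree\<close>). The group \<open>\<int>/n\<int>\<close> acts on the graph, so the characters
  \<open>k \<mapsto> \<zeta>\<^sup>k\<close> with \<open>\<zeta>\<^sup>n = 1\<close> split \<open>L\<close> into blocks of size two with rows \<open>(A(\<zeta>), B(\<zeta>\<^sup>-\<^sup>1))\<close> and
  \<open>(B(\<zeta>), A(\<zeta>))\<close>, whose determinant is \<open>P(\<zeta>)\<close>. The block of \<open>\<zeta> = 1\<close> has eigenvalues \<open>0\<close> and \<open>2 t\<close>.
  Comparing coefficients gives \<open>n \<tau>(n) = t \<Prod> P(\<zeta>)\<close>, the product over the \<open>n\<close>-th roots of unity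
  \<open>\<zeta> \<noteq> 1\<close> (\<open>dihedral_tau_eigenvalues\<close>).

  If \<open>P = 0\<close>, only \<open>\<tau>(1) = t\<close> survives. Otherwise \<open>z\<^sup>m P(z) = (z - 1)\<^sup>2 Q(z)\<close> with \<open>Q(1) \<noteq> 0\<close>; because
  \<open>P(z) = P(z\<^sup>-\<^sup>1)\<close>, the polynomial \<open>Q\<close> has even degree and both its extreme coefficients are \<open>\<eta>\<close>
  (\<open>dihedral_P_quotient\<close>). Hence the roots \<open>w\<^sub>i\<close> of \<open>Q\<close> have product \<open>1\<close>, and
  \<open>\<tau>(n) = C n ((-1)\<^sup>m \<eta>)\<^sup>n \<Prod> (1 - w\<^sub>i\<^sup>n)\<close> for a constant \<open>C\<close> (\<open>dihedral_tau_roots\<close>). Expanding the product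
  over the sets \<open>S\<close> of indices writes \<open>\<tau>(n)\<close> as \<open>n\<close> times a linear combination of powers \<open>\<mu>\<^sub>S\<^sup>n\<close> with
  \<open>\<mu>\<^sub>S = (-1)\<^sup>m \<eta> \<Prod>\<^bsub>i\<in>S\<^esub> w\<^sub>i\<close>. Complementary sets occur with the same sign and \<open>\<mu>\<^sub>S \<mu>\<^bsub>-S\<^esub> = \<eta>\<^sup>2\<close>
  (\<open>dihedral_tau_exponential_sum\<close>). This pairing is the source of the symmetry: if \<open>a b = c\<close>, then
  \<open>\<Sum> n (a\<^sup>n + b\<^sup>n) x\<^sup>n\<close> is a rational function of \<open>(1 + c x\<^sup>2) / x\<close> (\<open>paired_geometric_reciprocal\<close>), and
  for \<open>c = \<eta>\<^sup>2\<close> this argument is \<open>\<eta> (\<eta> x + 1 / (\<eta> x)) = 2 \<eta> u\<close>.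

  Numerator and denominator obtained in this way have complex coefficients. These satisfy
  homogeneous linear equations with integer coefficients, so a \<open>\<rat>\<close>-linear functional on \<open>\<complex>\<close> followed by
  clearing of denominators turns them into integers (\<open>reciprocal_ratfun_integral\<close>). The integral form
  in the variable \<open>u\<close> yields both claims.
\<close>

section \<open>Spanning trees as rooted trees\<close>

text \<open>
  The endpoint of \<open>e\<close> other than \<open>v\<close>, which is \<open>v\<close> itself if \<open>e\<close> is a loop at \<open>v\<close>.
\<close>

definition far_end :: "('e \<Rightarrow> 'v set) \<Rightarrow> 'v \<Rightarrow> 'e \<Rightarrow> 'v" where
  "far_end ends v e = (THE w. ends e = {v, w})"

lemma far_end_eq: "ends e = {v, w} \<Longrightarrow> far_end ends v e = w"
  unfolding far_end_def by (rule the_equality) (auto simp: doubleton_eq_iff)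

text \<open>
  A walk is built up edge by edge from its end. If the new first vertex already lies on the path, the
  path is cut off before that vertex. The edges of a path without repeated vertices are distinct
  because their endpoint sets are.
\<close>

lemma simple_path_between:
  assumes "(u, v) \<in> {(x, y). \<exists>e\<in>T. ends e = {x, y}}\<^sup>*"
  shows "\<exists>vs es. hd vs = u \<and> last vs = v \<and> distinct vs \<and> length vs = Suc (length es) \<and>
           distinct es \<and> set es \<subseteq> T \<and> (\<forall>i<length es. ends (es ! i) = {vs ! i, vs ! Suc i})"
proof -
  have "\<exists>vs es. hd vs = u \<and> last vs = v \<and> distinct vs \<and> length vs = Suc (length es) \<and>
           set es \<subseteq> T \<and> (\<forall>i<length es. ends (es ! i) = {vs ! i, vs ! Suc i})"
    using assms
  proof (induction rule: converse_rtrancl_induct)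
    case base
    show ?case by (rule exI[of _ "[v]"], rule exI[of _ "[]"]) simp
  next
    case (step u w)
    then obtain e where e: "e \<in> T" "ends e = {u, w}" by auto
    from step.IH obtain vs es where p: "hd vs = w" "last vs = v" "distinct vs"
      "length vs = Suc (length es)" "set es \<subseteq> T"
      "\<forall>i<length es. ends (es ! i) = {vs ! i, vs ! Suc i}" by blast
    have ne: "vs \<noteq> []" using p(4) by auto
    show ?case
    proof (cases "u \<in> set vs")
      case False
      have "\<forall>i<length (e # es). ends ((e # es) ! i) = {(u # vs) ! i, (u # vs) ! Suc i}"
      proof (intro allI impI)
        fix i assume "i < length (e # es)"
        then show "ends ((e # es) ! i) = {(u # vs) ! i, (u # vs) ! Suc i}"
          using p e ne by (cases i) (auto simp: hd_conv_nth)
      qed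
      then show ?thesis using p e ne False
        by (intro exI[of _ "u # vs"] exI[of _ "e # es"]) auto
    next
      case True
      then obtain k where k: "k < length vs" "vs ! k = u" by (auto simp: in_set_conv_nth)
      have "\<forall>i<length (drop k es). ends (drop k es ! i) = {drop k vs ! i, drop k vs ! Suc i}"
        using p(4,6) k by (auto simp: add.commute)
      moreover have "length (drop k vs) = Suc (length (drop k es))" using p(4) k by auto
      moreover have "set (drop k es) \<subseteq> T" using p(5) set_drop_subset[of k es] by blast
      ultimately show ?thesis using p k
        by (intro exI[of _ "drop k vs"] exI[of _ "drop k es"]) (auto simp: hd_drop_conv_nth)
    qed
  qed
  then obtain vs es where p: "hd vs = u" "last vs = v" "distinct vs"
      "length vs = Suc (length es)" "set es \<subseteq> T"
      "\<forall>i<length es. ends (es ! i) = {vs ! i, vs ! Suc i}" by blast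
  have "distinct es"
    unfolding distinct_conv_nth
  proof (intro allI impI notI)
    fix i j assume ij: "i < length es" "j < length es" "i \<noteq> j" "es ! i = es ! j"
    then have "{vs ! i, vs ! Suc i} = {vs ! j, vs ! Suc j}" using p(6) by metis
    then show False using ij p(3,4) by (auto simp: doubleton_eq_iff nth_eq_iff_index_eq)
  qed
  with p show ?thesis by blast
qed

locale multigraph =
  fixes V :: "'v set" and E :: "'e set" and ends :: "'e \<Rightarrow> 'v set"
  assumes fin_V: "finite V" and V_ne: "V \<noteq> {}" and fin_E: "finite E"
    and ends_ex: "e \<in> E \<Longrightarrow> \<exists>u\<in>V. \<exists>v\<in>V. ends e = {u, v}"
begin

definition incident :: "'v \<Rightarrow> 'e set" where
  "incident v = {e \<in> E. v \<in> ends e}"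

text \<open>
  A choice assigns to every vertex an incident edge, read as the edge to its parent, or \<open>None\<close>, which
  makes the vertex a root.
\<close>

definition choices :: "('v \<Rightarrow> 'e option) set" where
  "choices = (\<Pi>\<^sub>E v\<in>V. insert None (Some ` incident v))"

definition roots :: "('v \<Rightarrow> 'e option) \<Rightarrow> 'v set" where
  "roots f = {v \<in> V. f v = None}"

definition parent :: "('v \<Rightarrow> 'e option) \<Rightarrow> 'v \<Rightarrow> 'v" where
  "parent f v = (case f v of None \<Rightarrow> v | Some e \<Rightarrow> far_end ends v e)"

definition is_forest :: "('v \<Rightarrow> 'e option) \<Rightarrow> bool" where
  "is_forest f \<longleftrightarrow> (\<forall>v\<in>V. \<exists>k. (parent f ^^ k) v \<in> roots f)"

definition depth :: "('v \<Rightarrow> 'e option) \<Rightarrow> 'v \<Rightarrow> nat" where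
  "depth f v = (LEAST k. (parent f ^^ k) v \<in> roots f)"

definition chosen_edges :: "('v \<Rightarrow> 'e option) \<Rightarrow> 'e set" where
  "chosen_edges f = {e. \<exists>v\<in>V. f v = Some e}"

lemma incident_ends:
  assumes "e \<in> incident v" shows "ends e = {v, far_end ends v e}" "far_end ends v e \<in> V"
proof -
  from assms obtain a b where ab: "a \<in> V" "b \<in> V" "ends e = {a, b}" "v \<in> {a, b}"
    unfolding incident_def using ends_ex by force
  then obtain w where w: "w \<in> V" "ends e = {v, w}" by auto
  then show "ends e = {v, far_end ends v e}" "far_end ends v e \<in> V"
    using far_end_eq[of ends e v w] by auto
qed

lemma choices_Some: "f \<in> choices \<Longrightarrow> v \<in> V \<Longrightarrow> f v = Some e \<Longrightarrow> e \<in> incident v"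
  unfolding choices_def by (drule PiE_mem, assumption) auto

lemma choices_ends:
  assumes "f \<in> choices" "v \<in> V" "f v = Some e" 
  shows "ends e = {v, parent f v}" 
  using incident_ends[OF choices_Some[OF assms]] assms by (simp add: parent_def)

lemma parent_in: "f \<in> choices \<Longrightarrow> v \<in> V \<Longrightarrow> parent f v \<in> V"
  using choices_Some incident_ends by (cases "f v") (auto simp: parent_def)

lemma depth_parent:
  assumes "is_forest f" "v \<in> V" "f v \<noteq> None"
  shows "depth f (parent f v) < depth f v"
proof -
  obtain k where "(parent f ^^ k) v \<in> roots f" using assms unfolding is_forest_def by auto
  then have *: "(parent f ^^ depth f v) v \<in> roots f" unfolding depth_def by (rule LeastI)
  have "depth f v \<noteq> 0" by (rule notI) (use * assms in \<open>auto simp: roots_def\<close>)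
  then obtain d where d: "depth f v = Suc d" by (cases "depth f v") auto
  then have "(parent f ^^ d) (parent f v) \<in> roots f" using * by (simp add: funpow_swap1)
  then have "depth f (parent f v) \<le> d" unfolding depth_def by (rule Least_le)
  then show ?thesis using d by simp
qed

text \<open>
  Any function decreasing from each vertex to its parent can replace the depth.
\<close>

lemma is_forestI:
  fixes d :: "'v \<Rightarrow> nat"
  assumes "f \<in> choices" "\<And>v. v \<in> V \<Longrightarrow> f v \<noteq> None \<Longrightarrow> d (parent f v) < d v"
  shows "is_forest f"
proof -
  have "\<exists>k. (parent f ^^ k) v \<in> roots f" if "v \<in> V" for v
    using that
  proof (induction "d v" arbitrary: v rule: less_induct)
    case less
    show ?case
    proof (cases "f v")
      case None
      then show ?thesis using less by (intro exI[of _ 0]) (auto simp: roots_def)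
    next
      case (Some e)
      then obtain k where "(parent f ^^ k) (parent f v) \<in> roots f"
        using less.hyps[of "parent f v"] assms less.prems parent_in by auto
      then show ?thesis by (intro exI[of _ "Suc k"]) (simp add: funpow_swap1)
    qed
  qed
  then show ?thesis unfolding is_forest_def by blast
qed

definition rooted_trees :: "'v \<Rightarrow> ('v \<Rightarrow> 'e option) set" where
  "rooted_trees r = {f \<in> choices. is_forest f \<and> roots f = {r}}"

lemma rooted_trees_connected:
  assumes f: "f \<in> rooted_trees r"
  shows "mg_connected V ends (chosen_edges f)"
proof -
  let ?R = "{(x, y). \<exists>e\<in>chosen_edges f. ends e = {x, y}}"
  have ch: "f \<in> choices" and fo: "is_forest f" and ro: "roots f = {r}"
    using f by (auto simp: rooted_trees_def)
  have "sym ?R" by (auto simp: sym_def insert_commute)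
  then have sym: "sym (?R\<^sup>*)" by (rule sym_rtrancl)
  have to_root: "(v, r) \<in> ?R\<^sup>*" if "v \<in> V" for v
    using that
  proof (induction "depth f v" arbitrary: v rule: less_induct)
    case less
    show ?case
    proof (cases "f v")
      case None
      then have "v \<in> roots f" using less by (auto simp: roots_def)
      then show ?thesis using ro by simp
    next
      case (Some e)
      have "(v, parent f v) \<in> ?R"
        using Some less choices_ends[OF ch, of v e] by (auto simp: chosen_edges_def)
      moreover have "(parent f v, r) \<in> ?R\<^sup>*"
        using less Some depth_parent[OF fo] parent_in[OF ch] by auto
      ultimately show ?thesis by (rule converse_rtrancl_into_rtrancl)
    qed
  qed
  have "(u, v) \<in> ?R\<^sup>*" if "u \<in> V" "v \<in> V" for u v
    using to_root[OF that(1)] symD[OF sym to_root[OF that(2)]] by (rule rtrancl_trans)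
  then show ?thesis using V_ne unfolding mg_connected_def by blast
qed

text \<open>
  A deepest vertex of a cycle is not the parent of a vertex of the cycle, so the two cycle edges
  at it are both the edge that it chose; the cycle then has length one and the vertex would be
  its own parent.
\<close>

lemma rooted_trees_acyclic:
  assumes f: "f \<in> rooted_trees r"
  shows "mg_acyclic ends (chosen_edges f)"
  unfolding mg_acyclic_def
proof (intro notI, elim exE)
  fix vs es
  assume c: "mg_cycle ends (chosen_edges f) vs es"
  have ch: "f \<in> choices" and fo: "is_forest f" 
    using f by (auto simp: rooted_trees_def)
  define n where "n = length es"
  have n: "n > 0" "length vs = n" "length es = n" "distinct vs" "distinct es" "set es \<subseteq> chosen_edges f"
    and en: "\<And>i. i < n \<Longrightarrow> ends (es ! i) = {vs ! i, vs ! (Suc i mod n)}"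
    using c unfolding mg_cycle_def n_def by auto
  have "finite (depth f ` set vs)" "depth f ` set vs \<noteq> {}" using n by auto
  then have "Max (depth f ` set vs) \<in> depth f ` set vs" by (rule Max_in)
  then obtain i where i: "i < n" "depth f (vs ! i) = Max (depth f ` set vs)"
    using n by (auto simp: in_set_conv_nth)
  have top: "depth f w \<le> depth f (vs ! i)" if "w \<in> set vs" for w
    unfolding i(2) using that by simp
  have only: "f (vs ! i) = Some e" if "e \<in> chosen_edges f" "ends e = {vs ! i, w}" "w \<in> set vs" for e w
  proof -
    obtain u where u: "u \<in> V" "f u = Some e" using \<open>e \<in> chosen_edges f\<close> by (auto simp: chosen_edges_def)
    have eu: "ends e = {u, parent f u}" by (rule choices_ends[OF ch u])
    show ?thesis
    proof (cases "u = vs ! i")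
      case False
      then have "u = w" "parent f u = vs ! i" using eu that(2) by (auto simp: doubleton_eq_iff)
      then have "depth f (vs ! i) < depth f w" using depth_parent[OF fo u(1)] u by auto
      then show ?thesis using top[OF that(3)] by simp
    qed (use u in simp)
  qed
  \<comment> \<open>the index of the other cycle edge at \<open>vs ! i\<close>\<close>
  define j where "j = (if i = 0 then n - 1 else i - 1)"
  have j: "j < n" "Suc j mod n = i" using i n by (auto simp: j_def)
  have "ends (es ! j) = {vs ! i, vs ! j}" using en[OF j(1)] j(2) by (simp add: insert_commute)
  then have fj: "f (vs ! i) = Some (es ! j)"
    by (rule only[rotated]) (use n j in auto)
  have "f (vs ! i) = Some (es ! i)"
    by (rule only[OF _ en[OF i(1)]]) (use n i in auto)
  with fj have "es ! i = es ! j" by simp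
  then have "i = j" using n i j by (simp add: nth_eq_iff_index_eq)
  then have "ends (es ! i) = {vs ! i}" using en[OF j(1)] j(2) by simp
  moreover have "vs ! i \<in> V"
  proof -
    have "es ! i \<in> chosen_edges f" using n i by auto
    then obtain u where u: "u \<in> V" "f u = Some (es ! i)" by (auto simp: chosen_edges_def)
    then show ?thesis using choices_ends[OF ch u] \<open>ends (es ! i) = {vs ! i}\<close> by auto
  qed
  ultimately have "parent f (vs ! i) = vs ! i"
    using choices_ends[OF ch _ \<open>f (vs ! i) = Some (es ! i)\<close>] by auto
  then show False using depth_parent[OF fo \<open>vs ! i \<in> V\<close>] \<open>f (vs ! i) = Some (es ! i)\<close> by simp
qed

lemma chosen_edges_subset: "f \<in> choices \<Longrightarrow> chosen_edges f \<subseteq> E"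
  using choices_Some by (auto simp: chosen_edges_def incident_def)

text \<open>
  The depth in \<open>f\<close> can be used to compare \<open>f\<close> with \<open>g\<close>: the edge that \<open>f\<close> chooses at \<open>v\<close> is chosen in
  \<open>g\<close> by one of its endpoints, and the parent of \<open>v\<close> has already been shown to choose another edge.
\<close>

lemma chosen_edges_inj:
  "inj_on chosen_edges (rooted_trees r)"
proof (rule inj_onI)
  fix f g assume f: "f \<in> rooted_trees r" and g: "g \<in> rooted_trees r"
    and eq: "chosen_edges f = chosen_edges g"
  have cf: "f \<in> choices" and ff: "is_forest f" and rf: "roots f = {r}"
    and cg: "g \<in> choices" and fg: "is_forest g" and rg: "roots g = {r}"
    using f g by (auto simp: rooted_trees_def)
  have "f v = g v" if "v \<in> V" for v
    using that
  proof (induction "depth f v" arbitrary: v rule: less_induct)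
    case less
    show ?case
    proof (cases "f v")
      case None
      then have "v \<in> roots g" using less rf rg by (auto simp: roots_def)
      then show ?thesis using None by (simp add: roots_def)
    next
      case (Some e)
      have dp: "depth f (parent f v) < depth f v" using depth_parent[OF ff less.prems] Some by simp
      have pV: "parent f v \<in> V" using parent_in[OF cf less.prems] .
      have e: "ends e = {v, parent f v}" by (rule choices_ends[OF cf less.prems Some])
      have "e \<in> chosen_edges g" using eq Some less.prems by (auto simp: chosen_edges_def)
      then obtain w where w: "w \<in> V" "g w = Some e" by (auto simp: chosen_edges_def)
      have "w \<in> {v, parent f v}" using choices_ends[OF cg w] e by auto
      moreover have "w \<noteq> parent f v"
      proof
        assume *: "w = parent f v"
        then have fw: "f w = Some e" using less.hyps[OF dp pV] w by simp
        then have "ends e = {w, parent f w}" by (rule choices_ends[OF cf w(1)])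
        then have "parent f w = v" using e * by (auto simp: doubleton_eq_iff)
        then show False using depth_parent[OF ff w(1)] fw dp * by simp
      qed
      ultimately show ?thesis using w Some by auto
    qed
  qed
  then show "f = g" using cf cg unfolding choices_def by (intro PiE_ext) auto
qed

text \<open>
  Each vertex other than \<open>r\<close> chooses an edge of \<open>T\<close> that decreases the distance to \<open>r\<close>. The chosen edges
  already connect the graph, so a further edge of \<open>T\<close> would close a cycle.
\<close>

lemma spanning_tree_is_rooted_tree:
  assumes r: "r \<in> V" and T: "T \<in> spanning_trees V E ends"
  shows "\<exists>f\<in>rooted_trees r. chosen_edges f = T"
proof -
  let ?R = "{(x, y). \<exists>e\<in>T. ends e = {x, y}}"
  have TE: "T \<subseteq> E" and con: "mg_connected V ends T" and acy: "mg_acyclic ends T"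
    using T by (auto simp: spanning_trees_def)
  \<comment> \<open>the distance from \<open>r\<close> in \<open>T\<close>\<close>
  define d where "d v = (LEAST k. (r, v) \<in> ?R ^^ k)" for v
  have dist: "(r, v) \<in> ?R ^^ d v" if "v \<in> V" for v
  proof -
    have "(r, v) \<in> ?R\<^sup>*" using con r that by (auto simp: mg_connected_def)
    then obtain k where "(r, v) \<in> ?R ^^ k" using rtrancl_imp_relpow by blast
    then show ?thesis unfolding d_def by (rule LeastI)
  qed
  have closer: "\<exists>e. e \<in> T \<and> (\<exists>w. ends e = {v, w} \<and> d w < d v)" if "v \<in> V" "v \<noteq> r" for v
  proof -
    note reach = dist[OF that(1)]
    have "d v \<noteq> 0" by (rule notI) (use reach that(2) in simp)
    then obtain k where k: "d v = Suc k" by (cases "d v") auto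
    from reach[unfolded k] obtain w where w: "(r, w) \<in> ?R ^^ k" "(w, v) \<in> ?R"
      by (rule relpow_Suc_E)
    then have "d w \<le> k" unfolding d_def by (intro Least_le)
    then have "d w < d v" using k by simp
    moreover obtain e where "e \<in> T" "ends e = {v, w}" using w(2) by (auto simp: insert_commute)
    ultimately show ?thesis by blast
  qed
  define f where "f = (\<lambda>v\<in>V. if v = r then None else
      Some (SOME e. e \<in> T \<and> (\<exists>w. ends e = {v, w} \<and> d w < d v)))"
  have fr: "f r = None" using r by (simp add: f_def)
  have fv: "\<exists>e w. f v = Some e \<and> e \<in> T \<and> ends e = {v, w} \<and> d w < d v" if "v \<in> V" "v \<noteq> r" for v
    using someI_ex[OF closer[OF that]] that by (auto simp: f_def)
  have ch: "f \<in> choices"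
    unfolding choices_def
  proof (rule PiE_I)
    fix v assume v: "v \<in> V"
    show "f v \<in> insert None (Some ` incident v)"
    proof (cases "v = r")
      case False
      then show ?thesis using fv[OF v] TE by (auto simp: incident_def)
    qed (use fr in simp)
  qed (simp add: f_def)
  have "d (parent f v) < d v" if "v \<in> V" "f v \<noteq> None" for v
  proof -
    have "v \<noteq> r" using that fr by auto
    from fv[OF that(1) this] obtain e w where "f v = Some e" "ends e = {v, w}" "d w < d v" by blast
    then show ?thesis by (simp add: parent_def far_end_eq)
  qed
  then have "is_forest f" by (rule is_forestI[OF ch])
  moreover have "roots f = {r}" using r fr fv by (force simp: roots_def)
  ultimately have tr: "f \<in> rooted_trees r" using ch by (simp add: rooted_trees_def)
  have sub: "chosen_edges f \<subseteq> T"
  proof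
    fix e assume "e \<in> chosen_edges f"
    then obtain v where v: "v \<in> V" "f v = Some e" by (auto simp: chosen_edges_def)
    then have "v \<noteq> r" using fr by auto
    then show "e \<in> T" using fv[OF v(1)] v(2) by auto
  qed
  moreover have "T \<subseteq> chosen_edges f"
  proof (rule ccontr)
    assume "\<not> T \<subseteq> chosen_edges f"
    then obtain e where e: "e \<in> T" "e \<notin> chosen_edges f" by auto
    then obtain u v where uv: "u \<in> V" "v \<in> V" "ends e = {u, v}" using TE ends_ex by blast
    have "(u, v) \<in> {(x, y). \<exists>e\<in>chosen_edges f. ends e = {x, y}}\<^sup>*"
      using rooted_trees_connected[OF tr] uv unfolding mg_connected_def by blast
    from simple_path_between[OF this] obtain vs es where p: "hd vs = u" "last vs = v" "distinct vs"
      "length vs = Suc (length es)" "distinct es" "set es \<subseteq> chosen_edges f"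
      "\<forall>i<length es. ends (es ! i) = {vs ! i, vs ! Suc i}" by blast
    have ne: "vs \<noteq> []" using p(4) by auto
    have "ends ((es @ [e]) ! i) = {vs ! i, vs ! (Suc i mod length (es @ [e]))}"
      if "i < length (es @ [e])" for i
    proof (cases "i < length es")
      case True
      then show ?thesis using p(7) by (simp add: nth_append)
    next
      case False
      then have "i = length es" using that by simp
      then show ?thesis using p(1,2,4) uv ne by (simp add: hd_conv_nth last_conv_nth insert_commute)
    qed
    then have "mg_cycle ends T vs (es @ [e])"
      unfolding mg_cycle_def using p e sub by auto
    then show False using acy by (auto simp: mg_acyclic_def)
  qed
  ultimately show ?thesis using tr by auto
qed

lemma card_rooted_trees:
  assumes "r \<in> V"
  shows "card (rooted_trees r) = card (spanning_trees V E ends)"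
proof -
  have "chosen_edges ` rooted_trees r = spanning_trees V E ends"
  proof (intro equalityI subsetI)
    fix T assume "T \<in> chosen_edges ` rooted_trees r"
    then obtain f where f: "f \<in> rooted_trees r" "T = chosen_edges f" by auto
    then show "T \<in> spanning_trees V E ends"
      using rooted_trees_connected rooted_trees_acyclic chosen_edges_subset
      unfolding spanning_trees_def by (auto simp: rooted_trees_def)
  qed (use spanning_tree_is_rooted_tree[OF assms] in blast)
  then show ?thesis using card_image[OF chosen_edges_inj] by metis
qed

section \<open>The matrix-tree theorem\<close>

definition laplacian :: "'v \<Rightarrow> 'v \<Rightarrow> 'a :: idom" where
  "laplacian v w = (\<Sum>e\<in>incident v. of_bool (w = v) - of_bool (w = far_end ends v e))"

text \<open>
  The contribution to row \<open>v\<close> of \<open>x I + L\<close> of one option at \<open>v\<close>: a root contributes \<open>x\<close> on the diagonal, an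
  edge to the vertex \<open>w\<close> contributes \<open>1\<close> at \<open>v\<close> and \<open>-1\<close> at \<open>w\<close>.
\<close>

definition choice_entry :: "'a :: idom \<Rightarrow> 'v \<Rightarrow> 'e option \<Rightarrow> 'v \<Rightarrow> 'a" where
  "choice_entry x v c w = (case c of None \<Rightarrow> x * of_bool (w = v)
     | Some e \<Rightarrow> of_bool (w = v) - of_bool (w = far_end ends v e))"

text \<open>
  The matrix is triangular for every order of the vertices by depth. In terms of the Leibniz formula: a
  permutation with nonzero product sends each vertex to itself or to its parent, and a moved vertex
  of least depth would share its image with its parent.
\<close>

lemma det_choice_forest:
  assumes vtx: "bij_betw vtx {0..<N} V" and forest: "is_forest f"
  shows "det (mat N N (\<lambda>(i, j). choice_entry x (vtx i) (f (vtx i)) (vtx j))) = x ^ card (roots f)"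
proof -
  let ?m = "\<lambda>v w. choice_entry x v (f v) w"
  have inV: "vtx i \<in> V" if "i < N" for i using vtx that by (auto simp: bij_betw_def)
  have inj: "i = j" if "vtx i = vtx j" "i < N" "j < N" for i j
    using vtx that by (auto simp: bij_betw_def inj_on_def)
  have off_diag: "w = v \<or> (f v \<noteq> None \<and> w = parent f v)" if "?m v w \<noteq> 0" for v w
    using that by (auto simp: choice_entry_def parent_def split: option.splits if_splits)
  have only_id: "p = id" if p: "p permutes {0..<N}" and nz: "\<And>i. i < N \<Longrightarrow> ?m (vtx i) (vtx (p i)) \<noteq> 0" for p
  proof -
    have pN: "p i < N" if "i < N" for i using permutes_in_image[OF p, of i] that by simp
    have "p i = i" if "i < N" for i
      using that
    proof (induction "depth f (vtx i)" arbitrary: i rule: less_induct)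
      case less
      show ?case
      proof (rule ccontr)
        assume ne: "p i \<noteq> i"
        then have "vtx (p i) \<noteq> vtx i" using inj pN less.prems by blast
        with off_diag[OF nz[OF less.prems]] have s: "f (vtx i) \<noteq> None" "vtx (p i) = parent f (vtx i)"
            by auto
        then have "depth f (vtx (p i)) < depth f (vtx i)"
          using depth_parent[OF forest inV[OF less.prems]] by simp
        then have "p (p i) = p i" using less.hyps pN less.prems by blast
        then show False using ne permutes_inj[OF p] by (auto simp: inj_def)
      qed
    qed
    moreover have "p i = i" if "\<not> i < N" for i using permutes_not_in[OF p] that by simp
    ultimately show ?thesis by (auto simp: fun_eq_iff)
  qed
  have "det (mat N N (\<lambda>(i, j). ?m (vtx i) (vtx j)))
      = (\<Sum>p | p permutes {0..<N}. signof p * (\<Prod>i = 0..<N. ?m (vtx i) (vtx (p i))))"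
    unfolding det_def'[of _ N, OF mat_carrier]
  proof (intro sum.cong refl arg_cong2[of _ _ _ _ "(*)"] prod.cong)
    fix p i assume "p \<in> {p. p permutes {0..<N}}" "i \<in> {0..<N}"
    then show "mat N N (\<lambda>(i, j). ?m (vtx i) (vtx j)) $$ (i, p i) = ?m (vtx i) (vtx (p i))"
      using permutes_in_image[of p "{0..<N}" i] by simp
  qed
  also have "\<dots> = (\<Sum>p\<in>{id}. signof p * (\<Prod>i = 0..<N. ?m (vtx i) (vtx (p i))))"
  proof (rule sum.mono_neutral_right)
    show "\<forall>p\<in>{p. p permutes {0..<N}} - {id}. signof p * (\<Prod>i = 0..<N. ?m (vtx i) (vtx (p i))) = 0"
      using only_id by (fastforce simp: prod_zero_iff)
  qed (auto simp: finite_permutations permutes_id)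
  also have "\<dots> = (\<Prod>i = 0..<N. ?m (vtx i) (vtx i))" by simp
  also have "\<dots> = (\<Prod>v\<in>V. ?m v v)" by (rule prod.reindex_bij_betw[OF vtx])
  also have "\<dots> = (\<Prod>v\<in>V. if v \<in> roots f then x else 1)"
  proof (rule prod.cong[OF refl])
    fix v assume v: "v \<in> V"
    show "?m v v = (if v \<in> roots f then x else 1)"
    proof (cases "f v")
      case None
      then show ?thesis using v by (simp add: choice_entry_def roots_def)
    next
      case (Some e)
      then have "parent f v \<noteq> v" using depth_parent[OF forest v] by auto
      then show ?thesis using Some by (auto simp: choice_entry_def roots_def parent_def)
    qed
  qed
  also have "\<dots> = x ^ card (roots f)"
  proof -
    have "V \<inter> roots f = roots f" by (auto simp: roots_def)
    then show ?thesis using prod.inter_restrict[OF fin_V, of "\<lambda>_. x" "roots f"] by simp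
  qed
  finally show ?thesis .
qed

text \<open>
  The vertices from which no root is reached are closed under taking parents and under its inverse.
  Their indicator function is therefore a kernel vector.
\<close>

lemma det_choice_not_forest:
  assumes vtx: "bij_betw vtx {0..<N} V" and f: "f \<in> choices" and nf: "\<not> is_forest f"
  shows "det (mat N N (\<lambda>(i, j). choice_entry (x :: 'a :: idom) (vtx i) (f (vtx i)) (vtx j))) = 0"
    (is "det ?M = 0")
proof -
  define C where "C = {v\<in>V. \<forall>k. (parent f ^^ k) v \<notin> roots f}"
  define y :: "'a vec" where "y = vec N (\<lambda>j. of_bool (vtx j \<in> C))"
  have inV: "vtx i \<in> V" if "i < N" for i using vtx that by (auto simp: bij_betw_def)
  have None_C: "v \<notin> C" if "v \<in> V" "f v = None" for v
  proof -
    have "(parent f ^^ 0) v \<in> roots f" using that by (simp add: roots_def)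
    then show ?thesis unfolding C_def by blast
  qed
  have parent_C: "parent f v \<in> C \<longleftrightarrow> v \<in> C" if v: "v \<in> V" "f v \<noteq> None" for v
  proof
    assume c: "parent f v \<in> C"
    have "(parent f ^^ k) v \<notin> roots f" for k
    proof (cases k)
      case 0 then show ?thesis using v by (simp add: roots_def)
    next
      case (Suc l) then show ?thesis using c by (simp add: funpow_swap1 C_def)
    qed
    then show "v \<in> C" using v by (simp add: C_def)
  next
    assume c: "v \<in> C"
    have "(parent f ^^ k) (parent f v) \<notin> roots f" for k
      using c unfolding C_def by (metis (mono_tags, lifting) comp_apply funpow_Suc_right mem_Collect_eq)
    then show "parent f v \<in> C" using v f parent_in by (simp add: C_def)
  qed
  have row: "(\<Sum>w\<in>V. choice_entry x v (f v) w * of_bool (w \<in> C)) = 0" if v: "v \<in> V" for v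
  proof (cases "f v")
    case None
    have "(\<Sum>w\<in>V. choice_entry x v (f v) w * of_bool (w \<in> C)) = (\<Sum>w\<in>V. 0)"
      by (rule sum.cong) (use None None_C[OF v] in \<open>auto simp: choice_entry_def\<close>)
    then show ?thesis by simp
  next
    case (Some e)
    have e: "far_end ends v e = parent f v" using Some by (simp add: parent_def)
    have "(\<Sum>w\<in>V. choice_entry x v (f v) w * of_bool (w \<in> C))
        = (\<Sum>w\<in>V. (if w = v then of_bool (v \<in> C) else 0)
          - (if w = parent f v then of_bool (parent f v \<in> C) else 0))"
      by (rule sum.cong) (use Some e in \<open>auto simp: choice_entry_def\<close>)
    also have "\<dots> = of_bool (v \<in> C) - of_bool (parent f v \<in> C)"
      using v parent_in[OF f v] fin_V by (simp add: sum_subtractf)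
    also have "\<dots> = 0" using parent_C[OF v] Some by simp
    finally show ?thesis .
  qed
  have "?M *\<^sub>v y = 0\<^sub>v N"
  proof (rule eq_vecI)
    fix i assume "i < dim_vec (0\<^sub>v N :: 'a vec)"
    then have i: "i < N" by simp
    have "(?M *\<^sub>v y) $ i = (\<Sum>j = 0..<N. choice_entry x (vtx i) (f (vtx i)) (vtx j) * of_bool (vtx j \<in> C))"
      using i by (simp add: y_def scalar_prod_def)
    also have "\<dots> = (\<Sum>w\<in>V. choice_entry x (vtx i) (f (vtx i)) w * of_bool (w \<in> C))"
      by (rule sum.reindex_bij_betw[OF vtx])
    finally show "(?M *\<^sub>v y) $ i = 0\<^sub>v N $ i" using row[OF inV[OF i]] i by simp
  qed simp
  moreover have "y \<noteq> 0\<^sub>v N"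
  proof
    assume y0: "y = 0\<^sub>v N"
    obtain v where "v \<in> C" using nf unfolding is_forest_def C_def by auto
    moreover then have "v \<in> V" by (simp add: C_def)
    then obtain i where "i < N" "vtx i = v" using vtx by (auto simp: bij_betw_def)
    ultimately have "y $ i = 1" by (simp add: y_def)
    then show False using y0 \<open>i < N\<close> by simp
  qed
  moreover have "y \<in> carrier_vec N" by (simp add: y_def)
  ultimately show ?thesis using det_0_iff_vec_prod_zero[of ?M N] by auto
qed

text \<open>
  Every row of \<open>x I + L\<close> is the sum of the contributions of the options at its vertex, so
  multilinearity expands the determinant over all choices.
\<close>

lemma det_laplacian_forests:
  fixes x :: "'a :: idom"
  assumes vtx: "bij_betw vtx {0..<N} V"
  shows "det (mat N N (\<lambda>(i, j). x * of_bool (vtx j = vtx i) + laplacian (vtx i) (vtx j)))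
       = (\<Sum>f | f \<in> choices \<and> is_forest f. x ^ card (roots f))"
proof -
  let ?opts = "\<lambda>v. insert None (Some ` incident v)"
  have fin: "finite (incident v)" for v using fin_E by (simp add: incident_def)
  have fin_choices: "finite choices" unfolding choices_def by (intro finite_PiE fin_V) (simp add: fin)
  have entry: "x * of_bool (w = v) + laplacian v w = (\<Sum>c\<in>?opts v. choice_entry x v c w)" for v w
    using fin[of v] by (simp add: laplacian_def choice_entry_def sum.reindex)
  have pN: "p i < N" if "p permutes {0..<N}" "i < N" for p i
    using permutes_in_image[OF that(1), of i] that by simp
  have expand: "(\<Prod>i = 0..<N. \<Sum>c\<in>?opts (vtx i). choice_entry x (vtx i) c (vtx (p i)))
      = (\<Sum>f\<in>choices. \<Prod>i = 0..<N. choice_entry x (vtx i) (f (vtx i)) (vtx (p i)))" for p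
  proof -
    \<comment> \<open>a choice is a function on \<open>V\<close>, so the rows are temporarily indexed by vertices\<close>
    define idx where "idx = the_inv_into {0..<N} vtx"
    have idx: "idx (vtx i) = i" if "i < N" for i
      using vtx that unfolding idx_def by (simp add: bij_betw_def the_inv_into_f_f)
    have "(\<Prod>i = 0..<N. \<Sum>c\<in>?opts (vtx i). choice_entry x (vtx i) c (vtx (p i)))
        = (\<Prod>i = 0..<N. \<Sum>c\<in>?opts (vtx i). choice_entry x (vtx i) c (vtx (p (idx (vtx i)))))"
      by (rule prod.cong) (auto simp: idx)
    also have "\<dots> = (\<Prod>v\<in>V. \<Sum>c\<in>?opts v. choice_entry x v c (vtx (p (idx v))))"
      by (rule prod.reindex_bij_betw[OF vtx])
    also have "\<dots> = (\<Sum>f\<in>choices. \<Prod>v\<in>V. choice_entry x v (f v) (vtx (p (idx v))))"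
      unfolding choices_def by (rule prod_sum_PiE) (auto simp: fin_V fin)
    also have "\<dots> = (\<Sum>f\<in>choices. \<Prod>i = 0..<N. choice_entry x (vtx i) (f (vtx i)) (vtx (p (idx (vtx i)))))"
      by (intro sum.cong refl prod.reindex_bij_betw[OF vtx, symmetric])
    also have "\<dots> = (\<Sum>f\<in>choices. \<Prod>i = 0..<N. choice_entry x (vtx i) (f (vtx i)) (vtx (p i)))"
      by (intro sum.cong prod.cong refl) (auto simp: idx)
    finally show ?thesis .
  qed
  have "det (mat N N (\<lambda>(i, j). x * of_bool (vtx j = vtx i) + laplacian (vtx i) (vtx j)))
      = (\<Sum>p | p permutes {0..<N}. signof p *
          (\<Prod>i = 0..<N. \<Sum>c\<in>?opts (vtx i). choice_entry x (vtx i) c (vtx (p i))))"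
    unfolding det_def'[of _ N, OF mat_carrier]
    by (intro sum.cong refl arg_cong2[of _ _ _ _ "(*)"] prod.cong) (auto simp: entry pN)
  also have "\<dots> = (\<Sum>f\<in>choices. \<Sum>p | p permutes {0..<N}. signof p *
          (\<Prod>i = 0..<N. choice_entry x (vtx i) (f (vtx i)) (vtx (p i))))"
    unfolding expand sum_distrib_left by (rule sum.swap)
  also have "\<dots> = (\<Sum>f\<in>choices. det (mat N N (\<lambda>(i, j). choice_entry x (vtx i) (f (vtx i)) (vtx j))))"
    unfolding det_def'[of _ N, OF mat_carrier]
    by (intro sum.cong refl arg_cong2[of _ _ _ _ "(*)"] prod.cong) (auto simp: pN)
  also have "\<dots> = (\<Sum>f\<in>choices. if is_forest f then x ^ card (roots f) else 0)"
    by (intro sum.cong refl) (simp add: det_choice_forest[OF vtx] det_choice_not_forest[OF vtx])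
  also have "\<dots> = (\<Sum>f | f \<in> choices \<and> is_forest f. x ^ card (roots f))"
    using fin_choices by (simp add: sum.inter_filter)
  finally show ?thesis .
qed

text \<open>
  A forest contributes to the linear coefficient if it has exactly one root, and for each root there is
  one such forest for each spanning tree.
\<close>

lemma matrix_tree:
  fixes p :: "'a :: {idom, ring_char_0} poly"
  assumes vtx: "bij_betw vtx {0..<N} V"
    and p: "\<And>x. det (mat N N (\<lambda>(i, j). x * of_bool (vtx j = vtx i) + laplacian (vtx i) (vtx j))) = poly p x"
  shows "coeff p 1 = of_nat (card V * card (spanning_trees V E ends))"
proof -
  have fin_choices: "finite choices" unfolding choices_def
    by (intro finite_PiE fin_V) (use fin_E in \<open>simp add: incident_def\<close>)
  let ?q = "\<Sum>f | f \<in> choices \<and> is_forest f. monom (1 :: 'a) (card (roots f))"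
  have "poly p x = poly ?q x" for x
    using p[of x] det_laplacian_forests[OF vtx, of x] by (simp add: poly_sum poly_monom)
  then have "poly p = poly ?q" by (rule ext)
  then have "p = ?q" by (simp only: poly_eq_poly_eq_iff)
  then have "coeff p 1 = (\<Sum>f | f \<in> choices \<and> is_forest f. of_bool (card (roots f) = 1))"
    by (simp add: coeff_sum of_bool_def)
  also have "\<dots> = of_nat (card {f \<in> choices. is_forest f \<and> card (roots f) = 1})"
  proof -
    have "{f \<in> choices. is_forest f} \<inter> {f. card (roots f) = 1}
        = {f \<in> choices. is_forest f \<and> card (roots f) = 1}" by blast
    then show ?thesis using fin_choices by (simp add: sum_of_bool_eq)
  qed
  also have "{f \<in> choices. is_forest f \<and> card (roots f) = 1} = (\<Union>r\<in>V. rooted_trees r)"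
  proof -
    have "r \<in> V" if "roots f = {r}" for f r
      using that by (metis (no_types, lifting) insertI1 mem_Collect_eq roots_def)
    then show ?thesis by (auto simp: rooted_trees_def card_1_singleton_iff)
  qed
  also have "card (\<Union>r\<in>V. rooted_trees r) = (\<Sum>r\<in>V. card (rooted_trees r))"
    using fin_choices by (intro card_UN_disjoint fin_V) (auto simp: rooted_trees_def)
  also have "\<dots> = card V * card (spanning_trees V E ends)" by (simp add: card_rooted_trees)
  finally show ?thesis .
qed

end

section \<open>Evaluation of Laurent polynomials\<close>

definition laurent_eval :: "laurent_poly \<Rightarrow> complex \<Rightarrow> complex" where
  "laurent_eval p z = (\<Sum>k\<in>Poly_Mapping.keys p. of_int (Poly_Mapping.lookup p k) * z powi k)"

lemma laurent_eval_superset: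
  assumes "finite K" "Poly_Mapping.keys p \<subseteq> K"
  shows "laurent_eval p z = (\<Sum>k\<in>K. of_int (Poly_Mapping.lookup p k) * z powi k)"
  unfolding laurent_eval_def using assms
  by (intro sum.mono_neutral_left) (auto simp: in_keys_iff)

lemma laurent_eval_zero [simp]: "laurent_eval 0 z = 0"
  by (simp add: laurent_eval_def)

lemma laurent_eval_add: "laurent_eval (p + q) z = laurent_eval p z + laurent_eval q z"
proof -
  let ?K = "Poly_Mapping.keys p \<union> Poly_Mapping.keys q"
  have "laurent_eval (p + q) z = (\<Sum>k\<in>?K. of_int (Poly_Mapping.lookup (p + q) k) * z powi k)"
    by (rule laurent_eval_superset) (use Poly_Mapping.keys_add[of p q] in auto)
  moreover have "laurent_eval p z = (\<Sum>k\<in>?K. of_int (Poly_Mapping.lookup p k) * z powi k)"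
    by (rule laurent_eval_superset) auto
  moreover have "laurent_eval q z = (\<Sum>k\<in>?K. of_int (Poly_Mapping.lookup q k) * z powi k)"
    by (rule laurent_eval_superset) auto
  ultimately show ?thesis by (simp add: lookup_add sum.distrib ring_distribs)
qed

lemma laurent_eval_uminus: "laurent_eval (- p) z = - laurent_eval p z"
  using laurent_eval_add[of p "- p" z] by (simp add: eq_neg_iff_add_eq_0 add.commute)

lemma laurent_eval_diff: "laurent_eval (p - q) z = laurent_eval p z - laurent_eval q z"
  using laurent_eval_add[of p "- q" z] by (simp add: laurent_eval_uminus)

lemma laurent_eval_sum: "laurent_eval (sum f I) z = (\<Sum>i\<in>I. laurent_eval (f i) z)"
  by (induction I rule: infinite_finite_induct) (auto simp: laurent_eval_add)

lemma laurent_eval_single [simp]: "laurent_eval (Poly_Mapping.single k c) z = of_int c * z powi k"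
  by (subst laurent_eval_superset[of "{k}"]) auto

lemma laurent_sum_singles:
  "(p :: laurent_poly) = (\<Sum>k\<in>Poly_Mapping.keys p. Poly_Mapping.single k (Poly_Mapping.lookup p k))"
proof (rule poly_mapping_eqI)
  fix l
  have "Poly_Mapping.lookup (\<Sum>k\<in>Poly_Mapping.keys p. Poly_Mapping.single k (Poly_Mapping.lookup p k)) l
      = (\<Sum>k\<in>Poly_Mapping.keys p. if k = l then Poly_Mapping.lookup p l else 0)"
    by (simp add: lookup_sum lookup_single when_def)
  also have "\<dots> = Poly_Mapping.lookup p l" by (simp add: in_keys_iff)
  finally show "Poly_Mapping.lookup p l = Poly_Mapping.lookup (\<Sum>k\<in>Poly_Mapping.keys p.
      Poly_Mapping.single k (Poly_Mapping.lookup p k)) l" by simp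
qed

lemma laurent_eval_mult:
  assumes z: "z \<noteq> 0"
  shows "laurent_eval (p * q) z = laurent_eval p z * laurent_eval q z"
proof -
  have "p * q = (\<Sum>k\<in>Poly_Mapping.keys p. Poly_Mapping.single k (Poly_Mapping.lookup p k)) *
      (\<Sum>l\<in>Poly_Mapping.keys q. Poly_Mapping.single l (Poly_Mapping.lookup q l))"
    by (rule arg_cong2[of _ _ _ _ "(*)", OF laurent_sum_singles laurent_sum_singles])
  also have "\<dots> = (\<Sum>k\<in>Poly_Mapping.keys p. \<Sum>l\<in>Poly_Mapping.keys q.
      Poly_Mapping.single (k + l) (Poly_Mapping.lookup p k * Poly_Mapping.lookup q l))"
    by (simp add: sum_product mult_single)
  finally show ?thesis
    using z by (simp add: laurent_eval_sum power_int_add) (simp add: laurent_eval_def sum_product mult_ac)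
qed

lemma lookup_laurent_inv: "Poly_Mapping.lookup (laurent_inv p) k = Poly_Mapping.lookup p (- k)"
  unfolding laurent_inv_def by (simp add: map_key.rep_eq)

lemma laurent_eval_inv: "laurent_eval (laurent_inv p) z = laurent_eval p (inverse z)"
proof -
  have "Poly_Mapping.keys (laurent_inv p) = uminus ` Poly_Mapping.keys p"
    by (auto simp: in_keys_iff lookup_laurent_inv image_iff intro!: bexI[of _ "- _"])
  then show ?thesis
    by (simp add: laurent_eval_def sum.reindex lookup_laurent_inv power_int_minus power_int_inverse)
qed

text \<open>
  The polynomial \<open>z\<^sup>m p(z)\<close>, provided that no exponent of \<open>p\<close> is below \<open>-m\<close>.
\<close>

definition laurent_shift :: "nat \<Rightarrow> laurent_poly \<Rightarrow> complex poly" where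
  "laurent_shift m p = (\<Sum>k\<in>Poly_Mapping.keys p. monom (of_int (Poly_Mapping.lookup p k)) (nat (k + int m)))"

lemma
  assumes low: "\<And>k. k \<in> Poly_Mapping.keys p \<Longrightarrow> - int m \<le> k"
  shows coeff_laurent_shift: "coeff (laurent_shift m p) i = of_int (Poly_Mapping.lookup p (int i - int m))"
    and poly_laurent_shift: "z \<noteq> 0 \<Longrightarrow> poly (laurent_shift m p) z = z ^ m * laurent_eval p z"
proof -
  have "coeff (laurent_shift m p) i
      = (\<Sum>k\<in>Poly_Mapping.keys p. if k = int i - int m then of_int (Poly_Mapping.lookup p k) else 0)"
    unfolding laurent_shift_def coeff_sum coeff_monom
    by (intro sum.cong) (auto dest!: low)
  then show "coeff (laurent_shift m p) i = of_int (Poly_Mapping.lookup p (int i - int m))"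
    by (simp add: in_keys_iff)
  assume z: "z \<noteq> 0"
  have "poly (laurent_shift m p) z
      = (\<Sum>k\<in>Poly_Mapping.keys p. z ^ m * (of_int (Poly_Mapping.lookup p k) * z powi k))"
    unfolding laurent_shift_def poly_sum poly_monom
  proof (intro sum.cong refl)
    fix k assume "k \<in> Poly_Mapping.keys p"
    then have "k + int m \<ge> 0" using low by force
    then have "z ^ nat (k + int m) = z powi (k + int m)" by (simp add: power_int_def)
    then show "of_int (Poly_Mapping.lookup p k) * z ^ nat (k + int m)
        = z ^ m * (of_int (Poly_Mapping.lookup p k) * z powi k)"
      using z by (simp add: power_int_add)
  qed
  then show "poly (laurent_shift m p) z = z ^ m * laurent_eval p z"
    by (simp add: laurent_eval_def sum_distrib_left)
qed

lemma poly_eqI_nonzero: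
  fixes p q :: "'a :: {idom, ring_char_0} poly"
  assumes "\<And>z. z \<noteq> 0 \<Longrightarrow> poly p z = poly q z"
  shows "p = q"
proof -
  have "poly ([:0, 1:] * p) z = poly ([:0, 1:] * q) z" for z
    using assms[of z] by (cases "z = 0") auto
  then have "[:0, 1:] * p = [:0, 1:] * q" using poly_eq_poly_eq_iff by blast
  then show ?thesis by simp
qed

lemma laurent_keys_lower: "\<exists>m. \<forall>k\<in>Poly_Mapping.keys (p :: laurent_poly). - int m \<le> k"
proof -
  have "- int (\<Sum>l\<in>Poly_Mapping.keys p. nat \<bar>l\<bar>) \<le> k" if "k \<in> Poly_Mapping.keys p" for k
  proof -
    have "nat \<bar>k\<bar> \<le> (\<Sum>l\<in>Poly_Mapping.keys p. nat \<bar>l\<bar>)" by (rule member_le_sum) (use that in auto)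
    then show ?thesis by linarith
  qed
  then show ?thesis by blast
qed

text \<open>
  This transfers identities between functions on \<open>\<complex> - {0}\<close>, where \<open>z \<mapsto> z\<^sup>-\<^sup>1\<close> is easy to handle, to
  coefficients of Laurent polynomials.
\<close>

lemma laurent_eq_0I:
  assumes "\<And>z. z \<noteq> 0 \<Longrightarrow> laurent_eval p z = 0"
  shows "p = 0"
proof -
  obtain m where m: "\<And>k. k \<in> Poly_Mapping.keys p \<Longrightarrow> - int m \<le> k" using laurent_keys_lower by blast
  have "laurent_shift m p = 0"
    by (rule poly_eqI_nonzero) (simp add: poly_laurent_shift[OF m] assms)
  then have *: "Poly_Mapping.lookup p (int i - int m) = 0" for i
    using coeff_laurent_shift[where p = p and i = i, OF m] by simp
  have "k \<notin> Poly_Mapping.keys p" for k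
  proof
    assume k: "k \<in> Poly_Mapping.keys p"
    with m have "k = int (nat (k + int m)) - int m" by force
    then show False using *[of "nat (k + int m)"] k by (simp add: in_keys_iff)
  qed
  then show ?thesis by (metis ex_in_conv keys_eq_empty)
qed

lemma laurent_eval_A:
  "laurent_eval (dihedral_A s t \<beta>) z
     = of_nat (2 * s + t) - (\<Sum>i=1..s. z powi \<beta> i + z powi (- \<beta> i))"
  by (simp add: dihedral_A_def laurent_eval_diff laurent_eval_sum laurent_eval_add)

lemma laurent_eval_B: "laurent_eval (dihedral_B t \<gamma>) z = - (\<Sum>j=1..t. z powi \<gamma> j)"
  by (simp add: dihedral_B_def laurent_eval_uminus laurent_eval_sum)

lemma laurent_eval_A_inverse:
  "laurent_eval (dihedral_A s t \<beta>) (inverse z) = laurent_eval (dihedral_A s t \<beta>) z"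
  by (simp add: laurent_eval_A power_int_minus power_int_inverse add.commute)

lemma laurent_eval_P:
  assumes "z \<noteq> 0"
  shows "laurent_eval (dihedral_P s t \<beta> \<gamma>) z = (laurent_eval (dihedral_A s t \<beta>) z)\<^sup>2
    - laurent_eval (dihedral_B t \<gamma>) z * laurent_eval (dihedral_B t \<gamma>) (inverse z)"
  using assms by (simp add: dihedral_P_def laurent_eval_diff laurent_eval_mult laurent_eval_inv
      laurent_eval_A_inverse power2_eq_square)

lemma lookup_dihedral_P_uminus:
  "Poly_Mapping.lookup (dihedral_P s t \<beta> \<gamma>) (- k) = Poly_Mapping.lookup (dihedral_P s t \<beta> \<gamma>) k"
proof -
  let ?P = "dihedral_P s t \<beta> \<gamma>"
  have "laurent_inv ?P - ?P = 0"
  proof (rule laurent_eq_0I)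
    fix z :: complex assume "z \<noteq> 0"
    then show "laurent_eval (laurent_inv ?P - ?P) z = 0"
      by (simp add: laurent_eval_diff laurent_eval_inv laurent_eval_P laurent_eval_A_inverse mult.commute)
  qed
  then have "laurent_inv ?P = ?P" by simp
  then show ?thesis using lookup_laurent_inv[of ?P k] by simp
qed

section \<open>The double zero of the associated polynomial\<close>

text \<open>
  This is \<open>z\<^sup>K\<^sup>-\<^sup>d ((z\<^sup>d - 1) / (z - 1))\<^sup>2\<close> for \<open>0 \<le> d \<le> K\<close>, extended to negative \<open>d\<close> as an even
  function of \<open>d\<close>.
\<close>

definition square_quotient :: "nat \<Rightarrow> int \<Rightarrow> complex poly" where
  "square_quotient K d = monom 1 (K - nat \<bar>d\<bar>) * (\<Sum>i<nat \<bar>d\<bar>. monom 1 i)\<^sup>2"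

lemma poly_square_quotient_1: "poly (square_quotient K d) 1 = of_int (d\<^sup>2)"
proof -
  have "(of_int \<bar>d\<bar> :: complex)\<^sup>2 = of_int (d\<^sup>2)" by (simp only: of_int_power[symmetric] power2_abs)
  then show ?thesis by (simp add: square_quotient_def poly_sum poly_monom)
qed

text \<open>
  With \<open>e = \<bar>d\<bar>\<close>, the second factor on the left is \<open>(z\<^sup>e - 1)\<^sup>2 / z\<^sup>e\<close>.
\<close>

lemma power_symmetric_minus_2:
  assumes z: "z \<noteq> 0" and K: "\<bar>d\<bar> \<le> int K"
  shows "z ^ K * (z powi d + z powi (- d) - 2) = (z - 1)\<^sup>2 * poly (square_quotient K d) z"
proof -
  define e where "e = nat \<bar>d\<bar>"
  have "z powi d + z powi (- d) = z ^ e + inverse (z ^ e)"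
    unfolding e_def by (cases "d \<ge> 0") (auto simp: power_int_def power_inverse nat_minus_as_int)
  then have "z ^ e * (z powi d + z powi (- d) - 2) = (z ^ e - 1)\<^sup>2"
    using z by (simp add: field_simps power2_eq_square)
  moreover have "(z - 1) * (\<Sum>i<e. z ^ i) = z ^ e - 1" by (rule power_diff_1_eq[symmetric])
  then have "(z - 1)\<^sup>2 * poly (square_quotient K d) z = z ^ (K - e) * (z ^ e - 1)\<^sup>2"
    by (simp add: square_quotient_def e_def poly_sum poly_monom poly_power flip: power_mult_distrib)
  moreover have "z ^ K = z ^ (K - e) * z ^ e"
    using K by (simp add: e_def flip: power_add)
  ultimately show ?thesis by (simp add: mult.assoc)
qed

text \<open>
  Both \<open>A\<close> and \<open>B(z) B(z\<^sup>-\<^sup>1)\<close> are here expanded around their values \<open>t\<close> and \<open>t\<^sup>2\<close> at \<open>z = 1\<close>, which cancel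
  in \<open>P\<close>. What remains is a combination of the functions \<open>y d\<close>, each with a double zero at \<open>1\<close>; ordered
  pairs \<open>(j, k)\<close> count every difference of the \<open>\<gamma> j\<close> twice.
\<close>

lemma laurent_eval_P_differences:
  assumes z: "z \<noteq> 0"
  defines "y \<equiv> \<lambda>d :: int. z powi d + z powi (- d) - 2"
  shows "laurent_eval (dihedral_P s t \<beta> \<gamma>) z = - 2 * of_nat t * (\<Sum>i=1..s. y (\<beta> i))
    + (\<Sum>i=1..s. y (\<beta> i))\<^sup>2 - (\<Sum>j=1..t. \<Sum>k=1..t. y (\<gamma> j - \<gamma> k)) / 2"
proof -
  have A: "laurent_eval (dihedral_A s t \<beta>) z = of_nat t - (\<Sum>i=1..s. y (\<beta> i))"
    by (simp add: laurent_eval_A y_def sum_subtractf sum.distrib)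
  have BB: "laurent_eval (dihedral_B t \<gamma>) z * laurent_eval (dihedral_B t \<gamma>) (inverse z)
      = (\<Sum>j=1..t. \<Sum>k=1..t. z powi (\<gamma> j - \<gamma> k))"
    using z by (simp add: laurent_eval_B sum_product power_int_diff power_int_inverse divide_inverse)
  have "(\<Sum>j=1..t. \<Sum>k=1..t. y (\<gamma> j - \<gamma> k)) = (\<Sum>j=1..t. \<Sum>k=1..t. z powi (\<gamma> j - \<gamma> k))
      + (\<Sum>j=1..t. \<Sum>k=1..t. z powi (\<gamma> k - \<gamma> j)) - 2 * of_nat t * of_nat t"
    by (simp add: y_def sum.distrib sum_subtractf)
  also have "(\<Sum>j=1..t. \<Sum>k=1..t. z powi (\<gamma> k - \<gamma> j)) = (\<Sum>j=1..t. \<Sum>k=1..t. z powi (\<gamma> j - \<gamma> k))"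
    by (rule sum.swap)
  finally have "(\<Sum>j=1..t. \<Sum>k=1..t. y (\<gamma> j - \<gamma> k)) / 2
      = (\<Sum>j=1..t. \<Sum>k=1..t. z powi (\<gamma> j - \<gamma> k)) - of_nat t * of_nat t"
    by (simp add: field_simps)
  then show ?thesis
    unfolding laurent_eval_P[OF z] A BB by (simp add: power2_eq_square algebra_simps)
qed

text \<open>
  The zero of \<open>P\<close> at \<open>1\<close> is exactly double: dividing by \<open>(z - 1)\<^sup>2\<close> and putting \<open>z = 1\<close> leaves
  \<open>-2 t \<Sum> (\<beta> i)\<^sup>2 - \<Sum> (\<gamma> j - \<gamma> k)\<^sup>2 / 2\<close>. If this sum of nonpositive terms vanishes, there are no \<open>\<beta> i\<close> and
  all \<open>\<gamma> j\<close> coincide, and then \<open>P = 0\<close>.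
\<close>

lemma dihedral_P_factor:
  assumes t: "t \<ge> 1" and \<beta>: "\<forall>i\<in>{1..s}. 0 < \<beta> i"
    and nz: "dihedral_P s t \<beta> \<gamma> \<noteq> 0"
  shows "\<exists>N R. poly R 1 \<noteq> 0 \<and>
    (\<forall>z. z \<noteq> 0 \<longrightarrow> z ^ N * laurent_eval (dihedral_P s t \<beta> \<gamma>) z = (z - 1)\<^sup>2 * poly R z)"
proof -
  \<comment> \<open>any common bound of the exponents would do\<close>
  define K where "K = (\<Sum>i=1..s. nat \<bar>\<beta> i\<bar>) + (\<Sum>j=1..t. \<Sum>k=1..t. nat \<bar>\<gamma> j - \<gamma> k\<bar>)"
  have K1: "\<bar>\<beta> i\<bar> \<le> int K" if "i \<in> {1..s}" for i
  proof -
    have "nat \<bar>\<beta> i\<bar> \<le> (\<Sum>i=1..s. nat \<bar>\<beta> i\<bar>)" by (rule member_le_sum) (use that in auto)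
    then show ?thesis unfolding K_def by linarith
  qed
  have K2: "\<bar>\<gamma> j - \<gamma> k\<bar> \<le> int K" if "j \<in> {1..t}" "k \<in> {1..t}" for j k
  proof -
    have "nat \<bar>\<gamma> j - \<gamma> k\<bar> \<le> (\<Sum>k=1..t. nat \<bar>\<gamma> j - \<gamma> k\<bar>)"
      by (rule member_le_sum) (use that in auto)
    also have "\<dots> \<le> (\<Sum>j=1..t. \<Sum>k=1..t. nat \<bar>\<gamma> j - \<gamma> k\<bar>)"
      by (rule member_le_sum) (use that in auto)
    finally show ?thesis unfolding K_def by linarith
  qed
  define b where "b = (\<Sum>i=1..s. square_quotient K (\<beta> i))"
  define c where "c = (\<Sum>j=1..t. \<Sum>k=1..t. square_quotient K (\<gamma> j - \<gamma> k))"
  define R where "R = monom 1 K * Polynomial.smult (- 2 * of_nat t) b + [:-1, 1:]\<^sup>2 * b\<^sup>2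
      - monom 1 K * Polynomial.smult (1/2) c"
  have "z ^ (2 * K) * laurent_eval (dihedral_P s t \<beta> \<gamma>) z = (z - 1)\<^sup>2 * poly R z" if z: "z \<noteq> 0" for z
  proof -
    define y where "y = (\<lambda>d :: int. z powi d + z powi (- d) - 2)"
    define Y where "Y = (\<Sum>i=1..s. y (\<beta> i))"
    define Z where "Z = (\<Sum>j=1..t. \<Sum>k=1..t. y (\<gamma> j - \<gamma> k))"
    have b: "z ^ K * Y = (z - 1)\<^sup>2 * poly b z"
      unfolding b_def poly_sum sum_distrib_left Y_def y_def
      by (intro sum.cong refl power_symmetric_minus_2 z K1)
    have c: "z ^ K * Z = (z - 1)\<^sup>2 * poly c z"
      unfolding c_def poly_sum sum_distrib_left Z_def y_def
      by (intro sum.cong refl power_symmetric_minus_2 z K2)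
    have P: "laurent_eval (dihedral_P s t \<beta> \<gamma>) z = - 2 * of_nat t * Y + Y\<^sup>2 - Z / 2"
      unfolding Y_def Z_def y_def by (rule laurent_eval_P_differences[OF z])
    have zz: "z ^ (2 * K) = z ^ K * z ^ K" by (simp add: mult_2 power_add)
    have "z ^ (2 * K) * laurent_eval (dihedral_P s t \<beta> \<gamma>) z
        = z ^ K * (- 2 * of_nat t) * (z ^ K * Y) + (z ^ K * Y)\<^sup>2 - z ^ K * (z ^ K * Z) / 2"
      unfolding P zz by (simp add: power2_eq_square algebra_simps)
    also have "\<dots> = (z - 1)\<^sup>2 * poly R z"
      unfolding b c R_def by (simp add: poly_monom power2_eq_square algebra_simps)
    finally show ?thesis .
  qed
  moreover have "poly R 1 \<noteq> 0"
  proof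
    assume "poly R 1 = 0"
    define S where "S = (\<Sum>i=1..s. (\<beta> i)\<^sup>2)"
    define G where "G = (\<Sum>j=1..t. \<Sum>k=1..t. (\<gamma> j - \<gamma> k)\<^sup>2)"
    have "poly b 1 = of_int S" "poly c 1 = of_int G"
      unfolding b_def c_def S_def G_def by (simp_all add: poly_sum poly_square_quotient_1)
    then have eq: "poly R 1 = - of_int (4 * int t * S + G) / 2"
      by (simp add: R_def poly_monom power2_eq_square field_simps)
    have "- (of_int (4 * int t * S + G) :: complex) / 2 = 0"
      by (rule trans[OF eq[symmetric] \<open>poly R 1 = 0\<close>])
    then have sum0: "4 * int t * S + G = 0"
      by (simp only: divide_eq_0_iff neg_equal_0_iff_equal of_int_eq_0_iff numeral_neq_zero simp_thms)
    have "S \<ge> 0" "G \<ge> 0" unfolding S_def G_def by (auto intro!: sum_nonneg)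
    then have "0 \<le> int t * S" by simp
    moreover have "4 * (int t * S) + G = 0" using sum0 by (simp only: mult.assoc)
    ultimately have "int t * S = 0" "G = 0" using \<open>G \<ge> 0\<close> by linarith+
    then have "S = 0" using t by auto
    have "s = 0"
    proof (rule ccontr)
      assume "s \<noteq> 0"
      then have "(\<beta> 1)\<^sup>2 = 0" using \<open>S = 0\<close> unfolding S_def by (subst (asm) sum_nonneg_eq_0_iff) auto
      then show False using bspec[OF \<beta>, of 1] \<open>s \<noteq> 0\<close> by simp
    qed
    have eq: "\<gamma> j = \<gamma> k" if "j \<in> {1..t}" "k \<in> {1..t}" for j k
    proof -
      have "(\<Sum>k=1..t. (\<gamma> j - \<gamma> k)\<^sup>2) = 0"
        by (rule sum_nonneg_0[OF _ _ \<open>G = 0\<close>[unfolded G_def] that(1)]) (auto intro!: sum_nonneg)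
      then have "(\<gamma> j - \<gamma> k)\<^sup>2 = 0" by (rule sum_nonneg_0[rotated 2, OF _ that(2)]) auto
      then show ?thesis by simp
    qed
    have "dihedral_P s t \<beta> \<gamma> = 0"
    proof (rule laurent_eq_0I)
      fix z :: complex assume z: "z \<noteq> 0"
      have "(\<Sum>j=1..t. \<Sum>k=1..t. z powi (\<gamma> j - \<gamma> k) + z powi (- (\<gamma> j - \<gamma> k)) - 2) = (\<Sum>j=1..t. \<Sum>k=1..t. 0)"
      proof (intro sum.cong refl)
        fix j k assume "j \<in> {1..t}" "k \<in> {1..t}"
        then have "\<gamma> j - \<gamma> k = 0" using eq[of j k] by simp
        then show "z powi (\<gamma> j - \<gamma> k) + z powi (- (\<gamma> j - \<gamma> k)) - 2 = 0" by (simp only:) simp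
      qed
      then show "laurent_eval (dihedral_P s t \<beta> \<gamma>) z = 0"
        unfolding laurent_eval_P_differences[OF z] using \<open>s = 0\<close> by simp
    qed
    then show False using nz by simp
  qed
  ultimately show ?thesis by blast
qed

text \<open>
  Here \<open>m\<close> is the largest exponent of \<open>P\<close>, and by the symmetry of \<open>P\<close> the smallest is \<open>-m\<close> with the same
  coefficient \<open>\<eta>\<close>. So \<open>z\<^sup>m P(z)\<close> has degree \<open>2 m\<close>; its quotient by \<open>(z - 1)\<^sup>2\<close> has degree \<open>2 m - 2\<close>
  and the same extreme coefficients.
\<close>

lemma dihedral_P_quotient:
  assumes t: "t \<ge> 1" and \<beta>: "\<forall>i\<in>{1..s}. 0 < \<beta> i"
    and nz: "dihedral_P s t \<beta> \<gamma> \<noteq> 0"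
  defines "\<eta> \<equiv> of_int (dihedral_eta s t \<beta> \<gamma>) :: complex"
  shows "\<exists>m Q. \<eta> \<noteq> 0 \<and> poly Q 1 \<noteq> 0 \<and> even (degree Q) \<and> lead_coeff Q = \<eta> \<and> coeff Q 0 = \<eta> \<and>
    (\<forall>z. z \<noteq> 0 \<longrightarrow> z ^ m * laurent_eval (dihedral_P s t \<beta> \<gamma>) z = (z - 1)\<^sup>2 * poly Q z)"
proof -
  define P where "P = dihedral_P s t \<beta> \<gamma>"
  define M where "M = Max (Poly_Mapping.keys P)"
  define m where "m = nat M"
  have ne: "Poly_Mapping.keys P \<noteq> {}" using nz by (simp add: P_def)
  have M: "M \<in> Poly_Mapping.keys P" unfolding M_def by (rule Max_in) (use ne in auto)
  have sym: "Poly_Mapping.lookup P (- k) = Poly_Mapping.lookup P k" for k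
    unfolding P_def by (rule lookup_dihedral_P_uminus)
  have up: "k \<le> M" if "k \<in> Poly_Mapping.keys P" for k
    unfolding M_def by (rule Max_ge) (use that in auto)
  have low: "- M \<le> k" if "k \<in> Poly_Mapping.keys P" for k
    using up[of "- k"] that sym[of k] by (simp add: in_keys_iff)
  have M0: "M \<ge> 0" using low[OF M] by simp
  then have mM: "int m = M" by (simp add: m_def)
  have eta: "\<eta> = of_int (Poly_Mapping.lookup P M)"
    by (simp add: \<eta>_def dihedral_eta_def laurent_lead_def P_def M_def)
  have eta0: "\<eta> \<noteq> 0" using M by (simp add: eta in_keys_iff)
  define L where "L = laurent_shift m P"
  have coeffL: "coeff L i = of_int (Poly_Mapping.lookup P (int i - M))" for i
    unfolding L_def by (subst coeff_laurent_shift) (use low mM in auto)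
  have polyL: "poly L z = z ^ m * laurent_eval P z" if "z \<noteq> 0" for z
    unfolding L_def by (rule poly_laurent_shift) (use low mM that in auto)
  have "coeff L (2 * m) = \<eta>" using mM by (simp add: coeffL eta)
  moreover have "coeff L i = 0" if "i > 2 * m" for i
    using up[of "int i - M"] that mM by (auto simp: coeffL in_keys_iff)
  ultimately have degL: "degree L = 2 * m" using eta0
    by (intro antisym degree_le le_degree) auto
  have lcL: "lead_coeff L = \<eta>" using \<open>coeff L (2 * m) = \<eta>\<close> degL by simp
  have cL0: "coeff L 0 = \<eta>" using sym[of M] by (simp add: coeffL eta)
  have L0: "L \<noteq> 0" using eta0 cL0 by auto
  obtain N R where R1: "poly R 1 \<noteq> 0"
    and R: "\<And>z. z \<noteq> 0 \<Longrightarrow> z ^ N * laurent_eval P z = (z - 1)\<^sup>2 * poly R z"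
    using dihedral_P_factor[OF t \<beta> nz] unfolding P_def by blast
  \<comment> \<open>powers of \<open>z\<close> do not affect the order of vanishing at \<open>1\<close>\<close>
  have eq: "monom 1 N * L = monom 1 m * ([:-1, 1:]\<^sup>2 * R)"
  proof (rule poly_eqI_nonzero)
    fix z :: complex assume z: "z \<noteq> 0"
    have "poly (monom 1 N * L) z = z ^ m * (z ^ N * laurent_eval P z)"
      using polyL[OF z] by (simp add: poly_monom)
    then show "poly (monom 1 N * L) z = poly (monom 1 m * ([:-1, 1:]\<^sup>2 * R)) z"
      unfolding R[OF z] by (simp add: poly_monom)
  qed
  have [simp]: "order 1 (monom (1 :: complex) k) = 0" for k by (rule order_0I) (simp add: poly_monom)
  have "order 1 (monom 1 N * L) = order 1 L" using L0 by (subst order_mult) auto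
  moreover have "R \<noteq> 0" using R1 by auto
  then have "order 1 (monom 1 m * ([:-1, 1:]\<^sup>2 * R)) = 2"
    using order_0I[OF R1] order_power_n_n[of "1 :: complex" 2]
        by (simp add: order_mult del: power2_eq_square)
  ultimately have "order 1 L = 2" using eq by simp
  then obtain Q where Q: "L = [:-1, 1:]\<^sup>2 * Q" "\<not> [:-1, 1:] dvd Q"
    using order_decomp[OF L0, of 1] by auto
  have Q0: "Q \<noteq> 0" using Q(2) by auto
  have "2 * m = 2 + degree Q"
    using degL Q0 unfolding Q(1) by (subst (asm) degree_mult_eq) (auto simp: degree_power_eq)
  then have "even (degree Q)" by presburger
  moreover have "lead_coeff Q = \<eta>" using lcL unfolding Q(1) by (simp add: lead_coeff_mult lead_coeff_power)
  moreover have "coeff Q 0 = \<eta>" using cL0 unfolding Q(1) by (simp add: coeff_mult_0 coeff_0_power)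
  moreover have "poly Q 1 \<noteq> 0" using Q(2) by (simp add: poly_eq_0_iff_dvd)
  moreover have "z ^ m * laurent_eval P z = (z - 1)\<^sup>2 * poly Q z" if "z \<noteq> 0" for z
    using polyL[OF that] by (simp add: Q(1))
  ultimately show ?thesis using eta0 unfolding P_def by blast
qed

section \<open>The spectrum of the dihedral graph\<close>

text \<open>
  The action on functions on the vertices is more convenient than matrix entries: a loop contributes
  zero, and parallel edges need no special treatment.
\<close>

lemma (in multigraph) laplacian_apply:
  assumes v: "v \<in> V"
  shows "(\<Sum>w\<in>V. laplacian v w * y w) = (\<Sum>e\<in>incident v. y v - y (far_end ends v e))"
proof -
  have "(\<Sum>w\<in>V. laplacian v w * y w)
      = (\<Sum>e\<in>incident v. \<Sum>w\<in>V. (of_bool (w = v) - of_bool (w = far_end ends v e)) * y w)"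
    unfolding laplacian_def sum_distrib_right by (rule sum.swap)
  also have "\<dots> = (\<Sum>e\<in>incident v. y v - y (far_end ends v e))"
  proof (rule sum.cong[OF refl])
    fix e assume "e \<in> incident v"
    then have "far_end ends v e \<in> V" by (rule incident_ends)
    moreover have "(\<Sum>w\<in>V. (of_bool (w = v) - of_bool (w = far_end ends v e)) * y w)
        = (\<Sum>w\<in>V. if w = v then y v else 0)
          - (\<Sum>w\<in>V. if w = far_end ends v e then y (far_end ends v e) else 0)"
      unfolding sum_subtractf[symmetric] by (rule sum.cong) auto
    ultimately show "(\<Sum>w\<in>V. (of_bool (w = v) - of_bool (w = far_end ends v e)) * y w)
        = y v - y (far_end ends v e)"
      using v fin_V by simp
  qed
  finally show ?thesis .
qed

lemma diagonal_mult:
  fixes d e :: "nat \<Rightarrow> 'a :: comm_ring_1"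
  shows "mat n n (\<lambda>(i, j). if i = j then d j else 0) * mat n n (\<lambda>(i, j). if i = j then e j else 0)
    = mat n n (\<lambda>(i, j). if i = j then d j * e j else 0)"
proof (rule eq_matI)
  fix i j assume "i < dim_row (mat n n (\<lambda>(i, j). if i = j then d j * e j else 0))"
    "j < dim_col (mat n n (\<lambda>(i, j). if i = j then d j * e j else 0))"
  then have ij: "i < n" "j < n" by auto
  have "(\<Sum>l = 0..<n. (if i = l then d l else 0) * (if l = j then e j else 0))
      = (\<Sum>l = 0..<n. if l = i then if i = j then d j * e j else 0 else 0)"
    by (rule sum.cong) auto
  then show "(mat n n (\<lambda>(i, j). if i = j then d j else 0) * mat n n (\<lambda>(i, j). if i = j then e j else 0)) $$ (i, j)
      = mat n n (\<lambda>(i, j). if i = j then d j * e j else 0) $$ (i, j)"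
    using ij by (simp add: scalar_prod_def)
qed simp_all

lemma sum_UN_Un:
  assumes "finite I" "\<And>i. i \<in> I \<Longrightarrow> finite (F i)" "finite G"
    and "\<And>i j. i \<in> I \<Longrightarrow> j \<in> I \<Longrightarrow> i \<noteq> j \<Longrightarrow> F i \<inter> F j = {}" "\<And>i. i \<in> I \<Longrightarrow> F i \<inter> G = {}"
  shows "sum g ((\<Union>i\<in>I. F i) \<union> G) = (\<Sum>i\<in>I. sum g (F i)) + sum g G"
proof -
  have "(\<Union>i\<in>I. F i) \<inter> G = {}" using assms(5) by blast
  with assms have "sum g ((\<Union>i\<in>I. F i) \<union> G) = sum g (\<Union>i\<in>I. F i) + sum g G"
    by (intro sum.union_disjoint) auto
  also have "sum g (\<Union>i\<in>I. F i) = (\<Sum>i\<in>I. sum g (F i))"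
    by (rule sum.UNION_disjoint) (use assms in auto)
  finally show ?thesis .
qed

lemma mod_shift_iff:
  fixes k l b n :: int
  assumes "0 \<le> k" "k < n" "0 \<le> l" "l < n"
  shows "k = (l + b) mod n \<longleftrightarrow> l = (k - b) mod n"
proof
  assume "k = (l + b) mod n"
  then have "(k - b) mod n = (l + b - b) mod n" by (simp only: mod_diff_left_eq)
  then show "l = (k - b) mod n" using assms by simp
next
  assume "l = (k - b) mod n"
  then have "(l + b) mod n = (k - b + b) mod n" by (simp only: mod_add_left_eq)
  then show "k = (l + b) mod n" using assms by simp
qed

lemma powi_mod_root_of_unity:
  fixes \<zeta> :: complex
  assumes "n > 0" "\<zeta> ^ n = 1"
  shows "\<zeta> powi (k mod int n) = \<zeta> powi k"
proof -
  have nz: "\<zeta> \<noteq> 0" using assms by (auto simp: power_0_left)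
  have "\<zeta> powi k = \<zeta> powi (int n * (k div int n) + k mod int n)" by simp
  also have "\<dots> = (\<zeta> powi int n) powi (k div int n) * \<zeta> powi (k mod int n)"
    by (subst power_int_add) (use nz in \<open>auto simp: power_int_mult\<close>)
  also have "\<zeta> powi int n = 1" using assms by simp
  finally have "\<zeta> powi k = 1 powi (k div int n) * \<zeta> powi (k mod int n)" .
  then show ?thesis by simp
qed

text \<open>
  The contribution of the edges \<open>D l\<close> joining \<open>C l\<close> and \<open>C (l + b)\<close> in one layer of the graph. At \<open>C k\<close> these
  are \<open>D k\<close> and \<open>D (k - b)\<close>, which coincide and are a loop if \<open>n\<close> divides \<open>b\<close>; then the right-hand side
  vanishes as well.
\<close>

lemma laplacian_circulant_part:
  fixes \<zeta> c :: complex
  assumes n: "n > 0" and \<zeta>: "\<zeta> ^ n = 1" and k: "0 \<le> k" "k < int n"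
    and ends: "\<And>l. ends (D l) = {C l, C ((l + b) mod int n)}" and inj: "inj D"
    and y: "\<And>l. y (C l) = c * \<zeta> powi l"
  shows "(\<Sum>e\<in>D ` {k, (k - b) mod int n}. y (C k) - y (far_end ends (C k) e))
       = \<zeta> powi k * (c * (2 - (\<zeta> powi b + \<zeta> powi (- b))))"
proof -
  define l where "l = (k - b) mod int n"
  have nz: "\<zeta> \<noteq> 0" using n \<zeta> by (auto simp: power_0_left)
  have l: "0 \<le> l" "l < int n" using n by (auto simp: l_def)
  have kl: "k = (l + b) mod int n" using mod_shift_iff[OF k l, of b] by (simp add: l_def)
  have fk: "far_end ends (C k) (D k) = C ((k + b) mod int n)" by (rule far_end_eq[of ends, OF ends])
  have "ends (D l) = {C k, C l}" unfolding ends using kl by (simp add: insert_commute)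
  then have fl: "far_end ends (C k) (D l) = C l" by (rule far_end_eq[of ends])
  have yl: "y (C l) = c * \<zeta> powi (k - b)" unfolding y l_def using powi_mod_root_of_unity[OF n \<zeta>] by simp
  have ykb: "y (C ((k + b) mod int n)) = c * \<zeta> powi (k + b)"
    unfolding y using powi_mod_root_of_unity[OF n \<zeta>] by simp
  have "(\<Sum>e\<in>D ` {k, l}. y (C k) - y (far_end ends (C k) e))
      = 2 * y (C k) - y (C ((k + b) mod int n)) - y (C l)"
  proof (cases "l = k")
    case True
    then have "(k + b) mod int n = k" using kl by simp
    then show ?thesis using True fk by simp
  next
    case False
    then have "D k \<noteq> D l" using inj by (auto dest: injD)
    then show ?thesis using fk fl by simp
  qed
  also have "\<dots> = \<zeta> powi k * (c * (2 - (\<zeta> powi b + \<zeta> powi (- b))))"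
    unfolding yl ykb unfolding y using nz
        by (simp add: power_int_add power_int_diff power_int_minus field_simps)
  finally show ?thesis by (simp add: l_def)
qed

locale dihedral_graph =
  fixes s t :: nat and \<beta> \<gamma> :: "nat \<Rightarrow> int" and n :: nat
  assumes n_pos: "n > 0"
begin

abbreviation "verts \<equiv> dihedral_verts n"
abbreviation "ends \<equiv> dihedral_ends \<beta> \<gamma> n"

lemma finite_edges: "finite (dihedral_edges s t n)"
proof -
  have "dihedral_edges s t n \<subseteq> (\<lambda>(k, i). RotEdge k i) ` ({0..<int n} \<times> {1..s}) \<union>
    (\<lambda>(k, i). ReflEdge k i) ` ({0..<int n} \<times> {1..s}) \<union>
    (\<lambda>(k, i). CrossEdge k i) ` ({0..<int n} \<times> {1..t})"
    unfolding dihedral_edges_def by auto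
  then show ?thesis by (rule finite_subset) auto
qed

lemma Rot_in_verts: "Rot k \<in> verts \<longleftrightarrow> 0 \<le> k \<and> k < int n"
  and Refl_in_verts: "Refl k \<in> verts \<longleftrightarrow> 0 \<le> k \<and> k < int n"
  by (auto simp: dihedral_verts_def)

sublocale multigraph verts "dihedral_edges s t n" ends
proof
  show "finite verts" "verts \<noteq> {}" using n_pos by (auto simp: dihedral_verts_def)
  show "finite (dihedral_edges s t n)" by (rule finite_edges)
next
  fix e assume e: "e \<in> dihedral_edges s t n"
  have *: "Rot (k mod int n) \<in> verts" "Refl (k mod int n) \<in> verts" for k
    using n_pos by (simp_all add: Rot_in_verts Refl_in_verts)
  show "\<exists>u\<in>verts. \<exists>v\<in>verts. ends e = {u, v}"
  proof (cases e)
    case (RotEdge k i)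
    then have "Rot k \<in> verts" using e by (auto simp: dihedral_edges_def Rot_in_verts)
    then show ?thesis using * RotEdge by auto
  next
    case (ReflEdge k i)
    then have "Refl k \<in> verts" using e by (auto simp: dihedral_edges_def Refl_in_verts)
    then show ?thesis using * ReflEdge by auto
  next
    case (CrossEdge k i)
    then have "Rot k \<in> verts" using e by (auto simp: dihedral_edges_def Rot_in_verts)
    then show ?thesis using * CrossEdge by auto
  qed
qed

lemma incident_Rot:
  assumes k: "0 \<le> k" "k < int n"
  shows "incident (Rot k) = (\<Union>i\<in>{1..s}. (\<lambda>l. RotEdge l i) ` {k, (k - \<beta> i) mod int n}) \<union>
    CrossEdge k ` {1..t}"
proof (rule Set.set_eqI)
  fix e
  show "e \<in> incident (Rot k) \<longleftrightarrow> e \<in> (\<Union>i\<in>{1..s}. (\<lambda>l. RotEdge l i) ` {k, (k - \<beta> i) mod int n}) \<union>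
    CrossEdge k ` {1..t}"
  proof (cases e)
    case (RotEdge l i)
    then show ?thesis
      unfolding incident_def using k n_pos mod_shift_iff[OF k, of l "\<beta> i"]
      by (auto simp: dihedral_edges_def)
  next
    case (CrossEdge l j)
    then show ?thesis unfolding incident_def using k by (auto simp: dihedral_edges_def)
  next
    case (ReflEdge l i)
    then show ?thesis unfolding incident_def by auto
  qed
qed

lemma incident_Refl:
  assumes k: "0 \<le> k" "k < int n"
  shows "incident (Refl k) = (\<Union>i\<in>{1..s}. (\<lambda>l. ReflEdge l i) ` {k, (k - \<beta> i) mod int n}) \<union>
    (\<lambda>j. CrossEdge ((k + \<gamma> j) mod int n) j) ` {1..t}"
proof (rule Set.set_eqI)
  fix e
  show "e \<in> incident (Refl k) \<longleftrightarrow> e \<in> (\<Union>i\<in>{1..s}. (\<lambda>l. ReflEdge l i) ` {k, (k - \<beta> i) mod int n}) \<union>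
    (\<lambda>j. CrossEdge ((k + \<gamma> j) mod int n) j) ` {1..t}"
  proof (cases e)
    case (CrossEdge l j)
    then show ?thesis
      unfolding incident_def using k n_pos mod_shift_iff[OF k, of l "- \<gamma> j"]
      by (auto simp: dihedral_edges_def)
  next
    case (ReflEdge l i)
    then show ?thesis
      unfolding incident_def using k n_pos mod_shift_iff[OF k, of l "\<beta> i"]
      by (auto simp: dihedral_edges_def)
  next
    case (RotEdge l i)
    then show ?thesis unfolding incident_def by auto
  qed
qed

text \<open>
  The span of \<open>k \<mapsto> \<zeta>\<^sup>k\<close> on the rotations and of the same function on the reflections is invariant under
  the Laplacian, which acts on the coordinates \<open>(a, b)\<close> by the matrix with rows \<open>(A(\<zeta>), B(\<zeta>\<^sup>-\<^sup>1))\<close> and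
  \<open>(B(\<zeta>), A(\<zeta>))\<close>.
\<close>

lemma laplacian_on_character:
  fixes \<zeta> a b :: complex
  assumes \<zeta>: "\<zeta> ^ n = 1" and k: "0 \<le> k" "k < int n"
    and yRot: "\<And>l. y (Rot l) = a * \<zeta> powi l" and yRefl: "\<And>l. y (Refl l) = b * \<zeta> powi l"
  defines "A \<equiv> laurent_eval (dihedral_A s t \<beta>) \<zeta>"
    and "B \<equiv> laurent_eval (dihedral_B t \<gamma>) \<zeta>" and "B' \<equiv> laurent_eval (dihedral_B t \<gamma>) (inverse \<zeta>)"
  shows "(\<Sum>w\<in>verts. laplacian (Rot k) w * y w) = \<zeta> powi k * (a * A + b * B')"
    and "(\<Sum>w\<in>verts. laplacian (Refl k) w * y w) = \<zeta> powi k * (a * B + b * A)"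
proof -
  have nz: "\<zeta> \<noteq> 0" using n_pos \<zeta> by (auto simp: power_0_left)
  have A: "(\<Sum>i=1..s. \<zeta> powi k * (c * (2 - (\<zeta> powi \<beta> i + \<zeta> powi (- \<beta> i))))) + of_nat t * (c * \<zeta> powi k)
      = \<zeta> powi k * (c * A)" for c
  proof -
    define X where "X = (\<lambda>i. \<zeta> powi \<beta> i + \<zeta> powi (- \<beta> i))"
    have 1: "(\<Sum>i=1..s. \<zeta> powi k * (c * (2 - X i))) = \<zeta> powi k * (c * (2 * of_nat s - (\<Sum>i=1..s. X i)))"
      by (simp add: sum_distrib_left[symmetric] sum_subtractf)
    have 2: "A = of_nat (2 * s + t) - (\<Sum>i=1..s. X i)" by (simp add: A_def laurent_eval_A X_def)
    have "(\<Sum>i=1..s. \<zeta> powi k * (c * (2 - X i))) + of_nat t * (c * \<zeta> powi k) = \<zeta> powi k * (c * A)"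
      unfolding 1 2 by (simp add: algebra_simps)
    then show ?thesis by (simp only: X_def)
  qed
  have B: "(\<Sum>j=1..t. a * \<zeta> powi (k + \<gamma> j)) = - (\<zeta> powi k * (a * B))"
    unfolding B_def laurent_eval_B using nz
    by (simp add: power_int_add sum_distrib_left algebra_simps)
  have B': "(\<Sum>j=1..t. b * \<zeta> powi (k - \<gamma> j)) = - (\<zeta> powi k * (b * B'))"
    unfolding B'_def laurent_eval_B using nz
    by (simp add: power_int_diff power_int_inverse divide_inverse sum_distrib_left algebra_simps)
  let ?g = "\<lambda>v e. y v - y (far_end ends v e)"
  have "(\<Sum>e\<in>incident (Rot k). ?g (Rot k) e)
      = (\<Sum>i=1..s. \<Sum>e\<in>(\<lambda>l. RotEdge l i) ` {k, (k - \<beta> i) mod int n}. ?g (Rot k) e)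
        + (\<Sum>e\<in>CrossEdge k ` {1..t}. ?g (Rot k) e)"
    unfolding incident_Rot[OF k]
    by (rule sum_UN_Un) auto
  also have "(\<Sum>i=1..s. \<Sum>e\<in>(\<lambda>l. RotEdge l i) ` {k, (k - \<beta> i) mod int n}. ?g (Rot k) e)
      = (\<Sum>i=1..s. \<zeta> powi k * (a * (2 - (\<zeta> powi \<beta> i + \<zeta> powi (- \<beta> i)))))"
    by (intro sum.cong refl laplacian_circulant_part n_pos \<zeta> k) (auto simp: yRot inj_def)
  also have "(\<Sum>e\<in>CrossEdge k ` {1..t}. ?g (Rot k) e) = (\<Sum>j=1..t. a * \<zeta> powi k - b * \<zeta> powi (k - \<gamma> j))"
  proof (subst sum.reindex)
    show "inj_on (CrossEdge k) {1..t}" by (auto simp: inj_on_def)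
    have "?g (Rot k) (CrossEdge k j) = a * \<zeta> powi k - b * \<zeta> powi (k - \<gamma> j)" for j
    proof -
      have "far_end ends (Rot k) (CrossEdge k j) = Refl ((k - \<gamma> j) mod int n)"
        by (rule far_end_eq) simp
      then show ?thesis by (simp add: yRot yRefl powi_mod_root_of_unity[OF n_pos \<zeta>])
    qed
    then show "sum (?g (Rot k) \<circ> CrossEdge k) {1..t} = (\<Sum>j=1..t. a * \<zeta> powi k - b * \<zeta> powi (k - \<gamma> j))"
      by simp
  qed
  also have "\<dots> = of_nat t * (a * \<zeta> powi k) - (\<Sum>j=1..t. b * \<zeta> powi (k - \<gamma> j))"
    by (simp add: sum_subtractf)
  finally have "(\<Sum>e\<in>incident (Rot k). ?g (Rot k) e) = \<zeta> powi k * (a * A) + \<zeta> powi k * (b * B')"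
    using A[of a] B' by simp
  moreover have "Rot k \<in> verts" using k by (auto simp: dihedral_verts_def)
  ultimately show "(\<Sum>w\<in>verts. laplacian (Rot k) w * y w) = \<zeta> powi k * (a * A + b * B')"
    by (simp add: laplacian_apply ring_distribs)
  have "(\<Sum>e\<in>incident (Refl k). ?g (Refl k) e)
      = (\<Sum>i=1..s. \<Sum>e\<in>(\<lambda>l. ReflEdge l i) ` {k, (k - \<beta> i) mod int n}. ?g (Refl k) e)
        + (\<Sum>e\<in>(\<lambda>j. CrossEdge ((k + \<gamma> j) mod int n) j) ` {1..t}. ?g (Refl k) e)"
    unfolding incident_Refl[OF k]
    by (rule sum_UN_Un) auto
  also have "(\<Sum>i=1..s. \<Sum>e\<in>(\<lambda>l. ReflEdge l i) ` {k, (k - \<beta> i) mod int n}. ?g (Refl k) e)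
      = (\<Sum>i=1..s. \<zeta> powi k * (b * (2 - (\<zeta> powi \<beta> i + \<zeta> powi (- \<beta> i)))))"
    by (intro sum.cong refl laplacian_circulant_part n_pos \<zeta> k) (auto simp: yRefl inj_def)
  also have "(\<Sum>e\<in>(\<lambda>j. CrossEdge ((k + \<gamma> j) mod int n) j) ` {1..t}. ?g (Refl k) e)
      = (\<Sum>j=1..t. b * \<zeta> powi k - a * \<zeta> powi (k + \<gamma> j))"
  proof (subst sum.reindex)
    show "inj_on (\<lambda>j. CrossEdge ((k + \<gamma> j) mod int n) j) {1..t}" by (auto simp: inj_on_def)
    have "?g (Refl k) (CrossEdge ((k + \<gamma> j) mod int n) j) = b * \<zeta> powi k - a * \<zeta> powi (k + \<gamma> j)" for j
    proof -
      have "((k + \<gamma> j) mod int n - \<gamma> j) mod int n = k"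
        using k by (simp add: mod_simps)
      then have "far_end ends (Refl k) (CrossEdge ((k + \<gamma> j) mod int n) j) = Rot ((k + \<gamma> j) mod int n)"
        by (intro far_end_eq) (simp add: insert_commute)
      then show ?thesis by (simp add: yRot yRefl powi_mod_root_of_unity[OF n_pos \<zeta>])
    qed
    then show "sum (?g (Refl k) \<circ> (\<lambda>j. CrossEdge ((k + \<gamma> j) mod int n) j)) {1..t}
        = (\<Sum>j=1..t. b * \<zeta> powi k - a * \<zeta> powi (k + \<gamma> j))"
      by simp
  qed
  also have "\<dots> = of_nat t * (b * \<zeta> powi k) - (\<Sum>j=1..t. a * \<zeta> powi (k + \<gamma> j))"
    by (simp add: sum_subtractf)
  finally have "(\<Sum>e\<in>incident (Refl k). ?g (Refl k) e) = \<zeta> powi k * (b * A) + \<zeta> powi k * (a * B)"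
    using A[of b] B by simp
  moreover have "Refl k \<in> verts" using k by (auto simp: dihedral_verts_def)
  ultimately show "(\<Sum>w\<in>verts. laplacian (Refl k) w * y w) = \<zeta> powi k * (a * B + b * A)"
    by (simp add: laplacian_apply ring_distribs)
qed

definition vertex :: "nat \<Rightarrow> dihedral_vertex" where
  "vertex i = (if i < n then Rot (int i) else Refl (int (i - n)))"

lemma bij_betw_vertex: "bij_betw vertex {0..<n + n} verts"
proof (rule bij_betw_imageI)
  show "inj_on vertex {0..<n + n}" by (auto simp: inj_on_def vertex_def split: if_splits)
  show "vertex ` {0..<n + n} = verts"
  proof (intro equalityI subsetI)
    fix v assume "v \<in> vertex ` {0..<n + n}"
    then show "v \<in> verts" by (auto simp: vertex_def dihedral_verts_def split: if_splits)
  next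
    fix v assume "v \<in> verts"
    then show "v \<in> vertex ` {0..<n + n}"
    proof (cases v)
      case (Rot k)
      then have "nat k \<in> {0..<n + n}" "v = vertex (nat k)"
        using \<open>v \<in> verts\<close> by (auto simp: vertex_def Rot_in_verts)
      then show ?thesis by blast
    next
      case (Refl k)
      then have "n + nat k \<in> {0..<n + n}" "v = vertex (n + nat k)"
        using \<open>v \<in> verts\<close> by (auto simp: vertex_def Refl_in_verts)
      then show ?thesis by blast
    qed
  qed
qed

definition root_unity :: "nat \<Rightarrow> complex" where
  "root_unity j = cis (2 * pi * real j / real n)"

lemma root_unity_pow_n: "root_unity j ^ n = 1"
proof -
  have "root_unity j ^ n = cis (real n * (2 * pi * real j / real n))"
    unfolding root_unity_def by (rule DeMoivre)
  also have "real n * (2 * pi * real j / real n) = 2 * pi * real j" using n_pos by simp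
  finally show ?thesis by (simp add: cis_multiple_2pi)
qed

lemma root_unity_nz: "root_unity j \<noteq> 0"
  by (simp add: root_unity_def)

lemma root_unity_pow_commute: "root_unity i ^ j = root_unity j ^ i"
  by (simp add: root_unity_def DeMoivre mult_ac)

lemma root_unity_inj: "inj_on root_unity {..<n}"
  using bij_betw_roots_unity[OF n_pos] unfolding root_unity_def bij_betw_def by blast

lemma root_unity_orthogonal:
  assumes "i < n" "k < n"
  shows "(\<Sum>l<n. root_unity l ^ i * inverse (root_unity l ^ k)) = (if i = k then of_nat n else 0)"
proof -
  define z where "z = root_unity i / root_unity k"
  have "(\<Sum>l<n. root_unity l ^ i * inverse (root_unity l ^ k)) = (\<Sum>l<n. z ^ l)"
  proof (rule sum.cong[OF refl])
    fix l
    show "root_unity l ^ i * inverse (root_unity l ^ k) = z ^ l"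
      unfolding root_unity_pow_commute[of l]
          by (simp add: z_def divide_inverse power_mult_distrib power_inverse)
  qed
  also have "\<dots> = (if i = k then of_nat n else 0)"
  proof (cases "i = k")
    case True
    then show ?thesis by (simp add: z_def root_unity_nz)
  next
    case False
    then have "z \<noteq> 1" using root_unity_inj assms root_unity_nz[of k] by (auto simp: z_def inj_on_def)
    moreover have "(z - 1) * (\<Sum>l<n. z ^ l) = z ^ n - 1" by (rule power_diff_1_eq[symmetric])
    moreover have "z ^ n = 1" by (simp add: z_def power_divide root_unity_pow_n)
    ultimately show ?thesis using False by simp
  qed
  finally show ?thesis .
qed

definition fourier :: "complex mat" where
  "fourier = mat n n (\<lambda>(i, j). root_unity j ^ i)"

lemma det_fourier_nz: "det fourier \<noteq> 0"
proof
  let ?F' = "mat n n (\<lambda>(l, k). inverse (root_unity l ^ k))"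
  assume "det fourier = 0"
  have "fourier * ?F' = of_nat n \<cdot>\<^sub>m 1\<^sub>m n"
  proof (rule eq_matI)
    fix i k assume "i < dim_row (of_nat n \<cdot>\<^sub>m 1\<^sub>m n :: complex mat)"
        "k < dim_col (of_nat n \<cdot>\<^sub>m 1\<^sub>m n :: complex mat)"
    then show "(fourier * ?F') $$ (i, k) = (of_nat n \<cdot>\<^sub>m 1\<^sub>m n) $$ (i, k)"
      using root_unity_orthogonal[of i k]
      by (simp add: fourier_def scalar_prod_def atLeast0LessThan)
  qed (simp_all add: fourier_def)
  then have "det fourier * det ?F' = of_nat n ^ n"
    using det_mult[of fourier n ?F'] by (simp add: fourier_def)
  with \<open>det fourier = 0\<close> n_pos show False by simp
qed

text \<open>
  Two copies of the Fourier matrix conjugate \<open>x I + L\<close> to a matrix of four diagonal blocks, whose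
  determinant is that of a diagonal matrix because the blocks commute.
\<close>

lemma dihedral_det_eigenvalues:
  fixes x :: complex
  shows "det (mat (n + n) (n + n) (\<lambda>(i, j). x * of_bool (vertex j = vertex i) + laplacian (vertex i)
      (vertex j)))
    = (\<Prod>j<n. (x + laurent_eval (dihedral_A s t \<beta>) (root_unity j))\<^sup>2
        - laurent_eval (dihedral_B t \<gamma>) (root_unity j) * laurent_eval (dihedral_B t \<gamma>)
          (inverse (root_unity j)))"
    (is "det ?M = (\<Prod>j<n. (x + ?A j)\<^sup>2 - ?B j * ?B' j)")
proof -
  define Z :: "complex mat" where "Z = 0\<^sub>m n n"
  define W where "W = four_block_mat fourier Z Z fourier"
  define DA where "DA = mat n n (\<lambda>(i, j). if i = j then x + ?A j else 0)"
  define DB where "DB = mat n n (\<lambda>(i, j). if i = j then ?B j else 0)"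
  define DB' where "DB' = mat n n (\<lambda>(i, j). if i = j then ?B' j else 0)"
  define D where "D = four_block_mat DA DB' DB DA"
  have dims: "fourier \<in> carrier_mat n n" "Z \<in> carrier_mat n n" "DA \<in> carrier_mat n n"
    "DB \<in> carrier_mat n n" "DB' \<in> carrier_mat n n"
    by (simp_all add: fourier_def Z_def DA_def DB_def DB'_def)
  have W: "W \<in> carrier_mat (n + n) (n + n)" and D: "D \<in> carrier_mat (n + n) (n + n)"
    and M: "?M \<in> carrier_mat (n + n) (n + n)"
    unfolding W_def D_def using dims by auto
  have diag: "fourier * mat n n (\<lambda>(i, j). if i = j then d j else 0)
      = mat n n (\<lambda>(i, j). root_unity j ^ i * d j)" for d
  proof (rule eq_matI)
    fix i j assume "i < dim_row (mat n n (\<lambda>(i, j). root_unity j ^ i * d j))"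
        "j < dim_col (mat n n (\<lambda>(i, j). root_unity j ^ i * d j))"
    then have "i < n" "j < n" by auto
    then show "(fourier * mat n n (\<lambda>(i, j). if i = j then d j else 0)) $$ (i, j)
        = mat n n (\<lambda>(i, j). root_unity j ^ i * d j) $$ (i, j)"
      by (simp add: fourier_def scalar_prod_def if_distrib cong: if_cong)
  qed (simp_all add: fourier_def)
  have WD: "W * D = four_block_mat (fourier * DA) (fourier * DB') (fourier * DB) (fourier * DA)"
    unfolding W_def D_def
    by (subst mult_four_block_mat[of _ n n _ n _ n _ _ n _ n]) (use dims in \<open>auto simp: Z_def\<close>)
  have MW: "?M * W = W * D"
  proof (rule eq_matI)
    fix i j assume "i < dim_row (W * D)" "j < dim_col (W * D)"
    then have ij: "i < n + n" "j < n + n" using W D by auto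
    \<comment> \<open>column \<open>j\<close> of \<open>W\<close> is the character of \<open>root_unity l\<close> on one of the two layers\<close>
    define l where "l = (if j < n then j else j - n)"
    define m where "m = (if i < n then i else i - n)"
    have l: "l < n" and m: "m < n" using ij by (auto simp: l_def m_def)
    define a :: complex where "a = of_bool (j < n)"
    define b :: complex where "b = of_bool (\<not> j < n)"
    define y where "y v = (case v of Rot k \<Rightarrow> a * root_unity l powi k | Refl k \<Rightarrow> b * root_unity l powi k)" for v
    have yR: "y (Rot k) = a * root_unity l powi k" "y (Refl k) = b * root_unity l powi k" for k
      by (simp_all add: y_def)
    have Wy: "W $$ (k, j) = y (vertex k)" if "k < n + n" for k
      using that ij dims by (auto simp: W_def Z_def vertex_def y_def a_def b_def l_def fourier_def
          simp del: of_nat_diff)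
    have "(?M * W) $$ (i, j) = (\<Sum>k = 0..<n + n. (x * of_bool (vertex k = vertex i)
        + laplacian (vertex i) (vertex k)) * y (vertex k))"
      using ij W by (simp add: scalar_prod_def Wy)
    also have "\<dots> = (\<Sum>w\<in>verts. (x * of_bool (w = vertex i) + laplacian (vertex i) w) * y w)"
      by (rule sum.reindex_bij_betw[OF bij_betw_vertex])
    also have "\<dots> = (\<Sum>w\<in>verts. if w = vertex i then x * y (vertex i) else 0)
        + (\<Sum>w\<in>verts. laplacian (vertex i) w * y w)"
      unfolding sum.distrib[symmetric] by (rule sum.cong) (auto simp: ring_distribs)
    also have "(\<Sum>w\<in>verts. if w = vertex i then x * y (vertex i) else 0) = x * y (vertex i)"
      using bij_betw_vertex ij fin_V by (auto simp: bij_betw_def)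
    also have "x * y (vertex i) + (\<Sum>w\<in>verts. laplacian (vertex i) w * y w)
        = root_unity l ^ m * (if i < n then a * (x + ?A l) + b * ?B' l else a * ?B l + b * (x + ?A l))"
    proof (cases "i < n")
      case True
      then have v: "vertex i = Rot (int m)" by (simp add: vertex_def m_def)
      show ?thesis unfolding v yR
        using True m
        by (subst laplacian_on_character(1)[OF root_unity_pow_n _ _ yR]) (auto simp: algebra_simps)
    next
      case False
      then have v: "vertex i = Refl (int m)" by (simp add: vertex_def m_def)
      show ?thesis unfolding v yR
        using False m
        by (subst laplacian_on_character(2)[OF root_unity_pow_n _ _ yR]) (auto simp: algebra_simps)
    qed
    also have "\<dots> = (W * D) $$ (i, j)"
      unfolding WD unfolding DA_def DB_def DB'_def diag
      using ij by (auto simp: l_def m_def a_def b_def)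
    finally show "(?M * W) $$ (i, j) = (W * D) $$ (i, j)" .
  qed (use W D M in auto)
  have "det ?M * det W = det D * det W"
    unfolding det_mult[OF M W, symmetric] MW det_mult[OF W D] by (rule mult.commute)
  moreover have "det W = det fourier * det fourier"
    unfolding W_def using dims by (intro det_four_block_mat_lower_left_zero) (auto simp: Z_def)
  ultimately have "det ?M = det D" using det_fourier_nz
      by (simp only: mult_cancel_right mult_eq_0_iff simp_thms)
  also have "\<dots> = det (DA * DA - DB' * DB)"
  proof -
    have "DB * DA = DA * DB"
      unfolding DA_def DB_def diagonal_mult by (rule cong_mat) (auto simp: mult.commute)
    then show ?thesis unfolding D_def
      by (rule det_four_block_mat[OF dims(3) dims(5) dims(4) dims(3)])
  qed
  also have "DA * DA - DB' * DB = mat n n (\<lambda>(i, j). if i = j then (x + ?A j)\<^sup>2 - ?B j * ?B' j else 0)"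
  proof (rule eq_matI)
    fix i j assume "i < dim_row (mat n n (\<lambda>(i, j). if i = j then (x + ?A j)\<^sup>2 - ?B j * ?B' j else 0))"
      "j < dim_col (mat n n (\<lambda>(i, j). if i = j then (x + ?A j)\<^sup>2 - ?B j * ?B' j else 0))"
    then have "i < n" "j < n" by auto
    then show "(DA * DA - DB' * DB) $$ (i, j) = mat n n (\<lambda>(i, j). if i = j then (x + ?A j)\<^sup>2
        - ?B j * ?B' j else 0) $$ (i, j)"
      unfolding DA_def DB_def DB'_def diagonal_mult by (simp add: power2_eq_square mult.commute)
  qed (use dims in auto)
  also have "det \<dots> = (\<Prod>j<n. (x + ?A j)\<^sup>2 - ?B j * ?B' j)"
    by (subst det_lower_triangular[of n]) (auto simp: prod_list_diag_prod atLeast0LessThan)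
  finally show ?thesis .
qed

text \<open>
  The factor of the root of unity \<open>1\<close> in the preceding product is \<open>(x + t)\<^sup>2 - t\<^sup>2 = x (x + 2 t)\<close>. The linear
  coefficient of the whole product is therefore \<open>2 t\<close> times the product of the other factors at \<open>x = 0\<close>.
\<close>

lemma dihedral_tau_eigenvalues:
  "of_nat n * (of_nat (dihedral_tau s t \<beta> \<gamma> n) :: complex)
     = of_nat t * (\<Prod>j=1..<n. laurent_eval (dihedral_P s t \<beta> \<gamma>) (root_unity j))"
proof -
  let ?A = "\<lambda>j. laurent_eval (dihedral_A s t \<beta>) (root_unity j)"
  let ?B = "\<lambda>j. laurent_eval (dihedral_B t \<gamma>) (root_unity j)"
  let ?B' = "\<lambda>j. laurent_eval (dihedral_B t \<gamma>) (inverse (root_unity j))"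
  let ?q = "\<lambda>j. [:(?A j)\<^sup>2 - ?B j * ?B' j, 2 * ?A j, 1:]"
  have "poly (\<Prod>j<n. ?q j) x = (\<Prod>j<n. (x + ?A j)\<^sup>2 - ?B j * ?B' j)" for x
    unfolding poly_prod by (rule prod.cong) (auto simp: power2_eq_square algebra_simps)
  then have "coeff (\<Prod>j<n. ?q j) 1
      = of_nat (card verts * card (spanning_trees verts (dihedral_edges s t n) ends))"
    using dihedral_det_eigenvalues by (intro matrix_tree[OF bij_betw_vertex]) simp
  also have "card verts = 2 * n" using bij_betw_same_card[OF bij_betw_vertex] by simp
  also have "(\<Prod>j<n. ?q j) = ?q 0 * (\<Prod>j=1..<n. ?q j)"
    using n_pos by (simp add: lessThan_atLeast0 prod.atLeast_Suc_lessThan)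
  also have "?q 0 = [:0, 2 * of_nat t, 1:]"
    by (simp add: root_unity_def laurent_eval_A laurent_eval_B power2_eq_square)
  also have "coeff ([:0, 2 * of_nat t, 1:] * (\<Prod>j=1..<n. ?q j)) 1 = 2 * of_nat t * coeff (\<Prod>j=1..<n. ?q j) 0"
    by (simp add: coeff_mult)
  also have "coeff (\<Prod>j=1..<n. ?q j) 0 = (\<Prod>j=1..<n. laurent_eval (dihedral_P s t \<beta> \<gamma>) (root_unity j))"
    by (simp add: poly_0_coeff_0[symmetric] poly_prod laurent_eval_P root_unity_nz)
  finally show ?thesis by (simp add: dihedral_tau_def)
qed

end

section \<open>The number of spanning trees as an exponential sum\<close>

context dihedral_graph begin

lemma prod_root_unity_linear: "(\<Prod>j<n. [:- root_unity j, 1:]) = monom 1 n - 1"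
proof (rule poly_eqI_degree_lead_coeff[where n = n and A = "root_unity ` {..<n}"])
  have deg: "degree (\<Prod>j<n. [:- root_unity j, 1:]) = n"
    by (subst degree_prod_sum_eq) auto
  have "lead_coeff (\<Prod>j<n. [:- root_unity j, 1:]) = 1" by (subst lead_coeff_prod) simp
  then show "coeff (\<Prod>j<n. [:- root_unity j, 1:]) n = coeff (monom 1 n - 1) n"
    using n_pos by (simp add: deg)
  show "card (root_unity ` {..<n}) \<ge> n" by (simp add: card_image[OF root_unity_inj])
  show "degree (\<Prod>j<n. [:- root_unity j, 1:]) \<le> n" by (simp add: deg)
  show "degree (monom 1 n - 1 :: complex poly) \<le> n"
    by (intro degree_diff_le) (auto intro: degree_monom_le)
next
  fix z assume "z \<in> root_unity ` {..<n}"
  then show "poly (\<Prod>j<n. [:- root_unity j, 1:]) z = poly (monom 1 n - 1) z"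
    by (auto simp: poly_prod poly_monom root_unity_pow_n)
qed

lemma prod_root_unity: "(\<Prod>j<n. c - root_unity j) = c ^ n - 1"
  using arg_cong[OF prod_root_unity_linear, of "\<lambda>p. poly p c"] by (simp add: poly_prod poly_monom)

lemma prod_nontrivial_root_unity: "(\<Prod>j=1..<n. c - root_unity j) = (\<Sum>i<n. c ^ i)"
proof -
  have r0: "root_unity 0 = 1" by (simp add: root_unity_def)
  have "(monom 1 n - 1 :: complex poly) = [:-1, 1:] * (\<Sum>i<n. monom 1 i)"
  proof -
    have "(monom 1 1 :: complex poly) ^ n - 1 = (monom 1 1 - 1) * (\<Sum>i<n. monom 1 1 ^ i)"
      by (rule power_diff_1_eq)
    moreover have "(monom 1 1 - 1 :: complex poly) = [:-1, 1:]" by (simp add: monom_altdef one_pCons)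
    ultimately show ?thesis by (simp add: monom_power)
  qed
  moreover have "(\<Prod>j<n. [:- root_unity j, 1:]) = [:-1, 1:] * (\<Prod>j=1..<n. [:- root_unity j, 1:])"
    using n_pos r0 by (simp add: lessThan_atLeast0 prod.atLeast_Suc_lessThan)
  ultimately have "[:-1, 1:] * (\<Prod>j=1..<n. [:- root_unity j, 1:]) = [:-1, 1:] * (\<Sum>i<n. monom 1 i)"
    using prod_root_unity_linear by simp
  then have "(\<Prod>j=1..<n. [:- root_unity j, 1:]) = (\<Sum>i<n. monom 1 i)"
    by (subst (asm) mult_cancel_left) auto
  from arg_cong[OF this, of "\<lambda>p. poly p c"] show ?thesis by (simp add: poly_prod poly_sum poly_monom)
qed

text \<open>
  Over the \<open>n\<close>-th roots of unity \<open>\<zeta> \<noteq> 1\<close>, the product of the \<open>\<zeta>\<^sup>m\<close> is a sign, that of the \<open>(\<zeta> - 1)\<^sup>2\<close> is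
  \<open>n\<^sup>2\<close>, and that of the \<open>Q(\<zeta>)\<close> is \<open>1 / Q(1)\<close> times the resultant of \<open>z\<^sup>n - 1\<close> and \<open>Q\<close>.
\<close>

lemma dihedral_tau_roots:
  fixes Q :: "complex poly" and w :: "nat \<Rightarrow> complex"
  assumes PQ: "\<And>z. z \<noteq> 0 \<Longrightarrow> z ^ m * laurent_eval (dihedral_P s t \<beta> \<gamma>) z = (z - 1)\<^sup>2 * poly Q z"
    and Q: "Q = Polynomial.smult \<eta> (\<Prod>i<d. [:- w i, 1:])" and d: "even d" and Q1: "poly Q 1 \<noteq> 0"
  shows "of_nat (dihedral_tau s t \<beta> \<gamma> n)
    = of_nat t * (-1) ^ m / poly Q 1 * (of_nat n * (((-1) ^ m * \<eta>) ^ n * (\<Prod>i<d. 1 - w i ^ n)))"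
proof -
  let ?P = "laurent_eval (dihedral_P s t \<beta> \<gamma>)"
  have r0: "root_unity 0 = 1" by (simp add: root_unity_def)
  have minus1: "((-1 :: complex) ^ d) = 1" using d by simp
  have prod_Q: "(\<Prod>j<n. poly Q (root_unity j)) = \<eta> ^ n * (\<Prod>i<d. 1 - w i ^ n)"
  proof -
    have "(\<Prod>j<n. poly Q (root_unity j)) = (\<Prod>j<n. \<eta> * (\<Prod>i<d. root_unity j - w i))"
      by (simp add: Q poly_prod)
    also have "\<dots> = \<eta> ^ n * (\<Prod>i<d. \<Prod>j<n. root_unity j - w i)"
      unfolding prod.distrib
      by (subst prod.swap) simp
    also have "(\<Prod>i<d. \<Prod>j<n. root_unity j - w i) = (\<Prod>i<d. (-1) ^ n * (w i ^ n - 1))"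
    proof (rule prod.cong[OF refl])
      fix i
      have "(\<Prod>j<n. root_unity j - w i) = (\<Prod>j<n. - (w i - root_unity j))" by simp
      also have "\<dots> = (-1) ^ n * (w i ^ n - 1)" unfolding prod_uminus prod_root_unity by simp
      finally show "(\<Prod>j<n. root_unity j - w i) = (-1) ^ n * (w i ^ n - 1)" .
    qed
    also have "\<dots> = ((-1) ^ n) ^ d * (\<Prod>i<d. w i ^ n - 1)" by (simp add: prod.distrib)
    also have "((-1 :: complex) ^ n) ^ d = 1"
      by (subst power_mult[symmetric], subst mult.commute, subst power_mult) (simp add: minus1)
    also have "(\<Prod>i<d. w i ^ n - 1) = (\<Prod>i<d. - (1 - w i ^ n))" by simp
    also have "\<dots> = (\<Prod>i<d. 1 - w i ^ n)" unfolding prod_uminus by (simp add: minus1)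
    finally show ?thesis by simp
  qed
  have split: "(\<Prod>j<n. poly Q (root_unity j)) = poly Q 1 * (\<Prod>j=1..<n. poly Q (root_unity j))"
    using n_pos r0 by (simp add: lessThan_atLeast0 prod.atLeast_Suc_lessThan)
  have sign: "(\<Prod>j=1..<n. root_unity j ^ m) = ((-1) ^ m) ^ (n - 1)"
  proof -
    have "(\<Prod>j=1..<n. - root_unity j) = 1"
      using prod_nontrivial_root_unity[of 0] n_pos by (simp add: power_0_left)
    then have "(-1) ^ (n - 1) * (\<Prod>j=1..<n. root_unity j) = 1" by (simp add: prod_uminus)
    then have "(-1) ^ (n - 1) * ((-1) ^ (n - 1) * (\<Prod>j=1..<n. root_unity j)) = (-1) ^ (n - 1)" by simp
    then have "(\<Prod>j=1..<n. root_unity j) = (-1) ^ (n - 1)"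
      by (simp add: mult.assoc[symmetric] flip: power_mult_distrib)
    then show ?thesis by (simp add: prod_power_distrib[symmetric] power_mult[symmetric] mult.commute)
  qed
  have squares: "(\<Prod>j=1..<n. (root_unity j - 1)\<^sup>2) = (of_nat n)\<^sup>2"
  proof -
    have "(\<Prod>j=1..<n. (root_unity j - 1)\<^sup>2) = (\<Prod>j=1..<n. 1 - root_unity j)\<^sup>2"
      by (simp add: prod_power_distrib[symmetric] power2_commute)
    then show ?thesis using prod_nontrivial_root_unity[of 1] by simp
  qed
  have "((-1) ^ m) ^ (n - 1) * (\<Prod>j=1..<n. ?P (root_unity j))
      = (\<Prod>j=1..<n. root_unity j ^ m * ?P (root_unity j))"
    unfolding sign[symmetric] prod.distrib ..
  also have "\<dots> = (\<Prod>j=1..<n. (root_unity j - 1)\<^sup>2 * poly Q (root_unity j))"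
    by (intro prod.cong refl PQ root_unity_nz)
  also have "\<dots> = (of_nat n)\<^sup>2 * (\<Prod>j=1..<n. poly Q (root_unity j))"
    unfolding prod.distrib squares ..
  finally have eq: "((-1) ^ m) ^ (n - 1) * (\<Prod>j=1..<n. ?P (root_unity j))
      = (of_nat n)\<^sup>2 * (\<Prod>j=1..<n. poly Q (root_unity j))" .
  have "(\<Prod>j=1..<n. ?P (root_unity j))
      = ((-1) ^ m) ^ (n - 1) * (((-1) ^ m) ^ (n - 1) * (\<Prod>j=1..<n. ?P (root_unity j)))"
    by (simp add: mult.assoc[symmetric] flip: power_mult_distrib)
  also have "\<dots> = ((-1) ^ m) ^ (n - 1) * ((of_nat n)\<^sup>2 * (\<Prod>j=1..<n. poly Q (root_unity j)))"
    unfolding eq ..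
  also have "((-1 :: complex) ^ m) ^ (n - 1) = (-1) ^ m * ((-1) ^ m) ^ n"
    using n_pos by (cases n) (simp_all add: mult.assoc[symmetric] flip: power_mult_distrib)
  also have "(\<Prod>j=1..<n. poly Q (root_unity j)) = \<eta> ^ n * (\<Prod>i<d. 1 - w i ^ n) / poly Q 1"
    using split prod_Q Q1 by (simp add: field_simps)
  finally have "of_nat n * of_nat (dihedral_tau s t \<beta> \<gamma> n) = of_nat n *
      (of_nat t * (-1) ^ m / poly Q 1 * (of_nat n * (((-1) ^ m * \<eta>) ^ n * (\<Prod>i<d. 1 - w i ^ n))))"
    unfolding dihedral_tau_eigenvalues by (simp add: power_mult_distrib power2_eq_square)
  then show ?thesis using n_pos by (subst (asm) mult_left_cancel) auto
qed

end

text \<open>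
  The index set consists of the sets \<open>S\<close> of indices of roots of \<open>Q\<close>. The term of \<open>S\<close> is averaged with that of its
  complement, which has the same sign as the degree of \<open>Q\<close> is even; the product of the two bases is
  \<open>\<eta>\<^sup>2\<close> because the roots of \<open>Q\<close> have product \<open>1\<close>.
\<close>

lemma dihedral_tau_exponential_sum:
  assumes t: "t \<ge> 1" and \<beta>: "\<forall>i\<in>{1..s}. 0 < \<beta> i"
    and nz: "dihedral_P s t \<beta> \<gamma> \<noteq> 0"
  shows "\<exists>(I :: nat set set) c \<mu> \<nu>. finite I \<and>
    (\<forall>S\<in>I. \<mu> S * \<nu> S = of_int ((dihedral_eta s t \<beta> \<gamma>)\<^sup>2)) \<and>
    (\<forall>n>0. (of_nat (dihedral_tau s t \<beta> \<gamma> n) :: complex) = of_nat n * (\<Sum>S\<in>I. c S * (\<mu> S ^ n + \<nu> S ^ n)))"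
proof -
  define \<eta> :: complex where "\<eta> = of_int (dihedral_eta s t \<beta> \<gamma>)"
  obtain m Q where \<eta>: "\<eta> \<noteq> 0" and Q1: "poly Q 1 \<noteq> 0" and even: "even (degree Q)"
    and lead: "lead_coeff Q = \<eta>" and c0: "coeff Q 0 = \<eta>"
    and PQ: "\<And>z. z \<noteq> 0 \<Longrightarrow> z ^ m * laurent_eval (dihedral_P s t \<beta> \<gamma>) z = (z - 1)\<^sup>2 * poly Q z"
    using dihedral_P_quotient[OF assms] unfolding \<eta>_def by blast
  have "Q \<noteq> 0" using Q1 by auto
  then obtain A where A: "size A = degree Q" "Q = Polynomial.smult (lead_coeff Q) (\<Prod>x\<in>#A. [:-x, 1:])"
    using alg_closed_imp_factorization by blast
  obtain ws where ws: "mset ws = A" using ex_mset by blast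
  define d where "d = degree Q"
  define w where "w i = ws ! i" for i
  have len: "length ws = d" using A(1) ws by (auto simp: d_def)
  have "(\<Prod>x\<in>#A. [:-x, 1:]) = prod_list (map (\<lambda>x. [:-x, 1:]) ws)"
    unfolding ws[symmetric] by (simp add: prod_mset_prod_list[symmetric])
  also have "\<dots> = (\<Prod>i<d. [:- w i, 1:])"
    by (simp add: prod.list_conv_set_nth len w_def atLeast0LessThan)
  finally have Q: "Q = Polynomial.smult \<eta> (\<Prod>i<d. [:- w i, 1:])" using A(2) lead by simp
  have d: "even d" using even by (simp add: d_def)
  have "\<eta> = \<eta> * (\<Prod>i<d. - w i)"
    using c0 unfolding Q by (simp add: poly_0_coeff_0[symmetric] poly_prod)
  then have prod_w: "(\<Prod>i<d. w i) = 1" using \<eta> d by (simp add: prod_uminus)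
  define e where "e = (-1) ^ m * \<eta>"
  define K where "K = of_nat t * (-1) ^ m / poly Q 1"
  define I where "I = Pow {..<d}"
  define c where "c S = K * (-1) ^ card S / 2" for S :: "nat set"
  define \<mu> where "\<mu> S = e * (\<Prod>i\<in>S. w i)" for S
  define \<nu> where "\<nu> S = \<mu> ({..<d} - S)" for S
  have e2: "e * e = \<eta>\<^sup>2" by (simp add: e_def power2_eq_square mult_ac flip: power_mult_distrib)
  have "\<mu> S * \<nu> S = of_int ((dihedral_eta s t \<beta> \<gamma>)\<^sup>2)" if "S \<in> I" for S
  proof -
    have "(\<Prod>i\<in>{..<d} - S. w i) * (\<Prod>i\<in>S. w i) = 1"
      using prod.subset_diff[of S "{..<d}" w] that prod_w by (simp add: I_def)
    then have "\<mu> S * \<nu> S = e * e" by (simp add: \<mu>_def \<nu>_def mult_ac)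
    then show ?thesis by (simp add: e2 \<eta>_def)
  qed
  moreover have "of_nat (dihedral_tau s t \<beta> \<gamma> n) = of_nat n * (\<Sum>S\<in>I. c S * (\<mu> S ^ n + \<nu> S ^ n))"
    if "n > 0" for n
  proof -
    interpret dihedral_graph s t \<beta> \<gamma> n by unfold_locales (rule that)
    define f where "f S = (-1) ^ card S * \<mu> S ^ n" for S
    have "e ^ n * (\<Prod>i<d. 1 - w i ^ n) = (\<Sum>S\<in>I. f S)"
      unfolding I_def by (subst prod_diff_conv_sum)
        (simp_all add: sum_distrib_left f_def \<mu>_def power_mult_distrib prod_power_distrib mult_ac)
    moreover have "(\<Sum>S\<in>I. f S) = (\<Sum>S\<in>I. f ({..<d} - S))"
      by (rule sum.reindex_bij_witness[of _ "\<lambda>S. {..<d} - S" "\<lambda>S. {..<d} - S"])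
         (auto simp: I_def double_diff)
    moreover have "(\<Sum>S\<in>I. f ({..<d} - S)) = (\<Sum>S\<in>I. (-1) ^ card S * \<nu> S ^ n)"
    proof (rule sum.cong[OF refl])
      fix S assume "S \<in> I"
      then have "card ({..<d} - S) + card S = d"
        using card_Diff_subset[of S "{..<d}"] card_mono[of "{..<d}" S] finite_subset[of S "{..<d}"]
        by (auto simp: I_def)
      then have "even (card ({..<d} - S) + card S)" using d by simp
      then have "even (card ({..<d} - S)) = even (card S)" by simp
      then show "f ({..<d} - S) = (-1) ^ card S * \<nu> S ^ n"
        by (simp add: f_def \<nu>_def minus_one_power_iff)
    qed
    ultimately have "e ^ n * (\<Prod>i<d. 1 - w i ^ n)
        = ((\<Sum>S\<in>I. (-1) ^ card S * \<mu> S ^ n) + (\<Sum>S\<in>I. (-1) ^ card S * \<nu> S ^ n)) / 2"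
      by (simp add: f_def)
    also have "\<dots> = (\<Sum>S\<in>I. (-1) ^ card S / 2 * (\<mu> S ^ n + \<nu> S ^ n))"
      by (simp add: sum.distrib[symmetric] sum_divide_distrib ring_distribs add_divide_distrib)
    finally have "K * (e ^ n * (\<Prod>i<d. 1 - w i ^ n)) = (\<Sum>S\<in>I. c S * (\<mu> S ^ n + \<nu> S ^ n))"
      by (simp add: sum_distrib_left c_def mult_ac)
    then show ?thesis
      using dihedral_tau_roots[OF PQ Q d Q1] unfolding K_def[symmetric] e_def[symmetric]
      by (simp add: mult_ac)
  qed
  moreover have "finite I" by (simp add: I_def)
  ultimately show ?thesis by blast
qed

section \<open>Power series invariant under inversion of the variable\<close>

text \<open>
  The polynomial \<open>x\<^sup>N h((1 + c x\<^sup>2) / x)\<close>, for \<open>h\<close> of degree at most \<open>N\<close>. The rational functions of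
  \<open>(1 + c x\<^sup>2) / x\<close> are, for \<open>c \<noteq> 0\<close>, those invariant under \<open>x \<mapsto> 1 / (c x)\<close>.
\<close>

definition reciprocal_subst :: "'a :: comm_ring_1 \<Rightarrow> nat \<Rightarrow> 'a poly \<Rightarrow> 'a poly" where
  "reciprocal_subst c N h = (\<Sum>i\<le>N. Polynomial.smult (coeff h i) ([:1, 0, c:] ^ i * [:0, 1:] ^ (N - i)))"

lemma poly_reciprocal_subst:
  fixes x :: "'a :: field"
  assumes x: "x \<noteq> 0" and deg: "degree h \<le> N"
  shows "poly (reciprocal_subst c N h) x = x ^ N * poly h ((1 + c * x\<^sup>2) / x)"
proof -
  have "poly (reciprocal_subst c N h) x = (\<Sum>i\<le>N. x ^ N * (coeff h i * ((1 + c * x\<^sup>2) / x) ^ i))"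
    unfolding reciprocal_subst_def poly_sum
  proof (rule sum.cong[OF refl])
    fix i assume "i \<in> {..N}"
    then have "x ^ N = x ^ (N - i) * x ^ i" by (simp flip: power_add)
    then show "poly (Polynomial.smult (coeff h i) ([:1, 0, c:] ^ i * [:0, 1:] ^ (N - i))) x
        = x ^ N * (coeff h i * ((1 + c * x\<^sup>2) / x) ^ i)"
      using x by (simp add: power_divide power2_eq_square mult_ac)
  qed
  also have "\<dots> = x ^ N * (\<Sum>i\<le>N. coeff h i * ((1 + c * x\<^sup>2) / x) ^ i)"
    by (rule sum_distrib_left[symmetric])
  also have "(\<Sum>i\<le>N. coeff h i * ((1 + c * x\<^sup>2) / x) ^ i) = poly h ((1 + c * x\<^sup>2) / x)"
    unfolding poly_altdef using deg by (intro sum.mono_neutral_right) (auto simp: coeff_eq_0)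
  finally show ?thesis .
qed

lemma reciprocal_subst_mult:
  fixes f g :: "complex poly"
  assumes "degree f \<le> M" "degree g \<le> N"
  shows "reciprocal_subst c (M + N) (f * g) = reciprocal_subst c M f * reciprocal_subst c N g"
proof (rule poly_eqI_nonzero)
  fix z :: complex assume z: "z \<noteq> 0"
  have "degree (f * g) \<le> M + N" using degree_mult_le[of f g] assms by simp
  then show "poly (reciprocal_subst c (M + N) (f * g)) z
      = poly (reciprocal_subst c M f * reciprocal_subst c N g) z"
    using z assms by (simp add: poly_reciprocal_subst power_add mult_ac)
qed

lemma reciprocal_subst_add:
  "reciprocal_subst c N (f + g) = reciprocal_subst c N f + reciprocal_subst c N g"
  by (simp add: reciprocal_subst_def smult_add_left sum.distrib)

lemma fps_one_minus_cX_mult_nth: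
  "((1 - fps_const c * fps_X) * F) $ n = F $ n - (if n = 0 then 0 else c * F $ (n - 1))"
  for F :: "'a :: comm_ring_1 fps"
  by (simp add: left_diff_distrib mult.assoc)

text \<open>
  The expansion \<open>\<Sum> n a\<^sup>n x\<^sup>n = a x / (1 - a x)\<^sup>2\<close>.
\<close>

lemma fps_nat_times_geometric:
  fixes a :: complex
  shows "(1 - fps_const a * fps_X)\<^sup>2 * Abs_fps (\<lambda>n. of_nat n * a ^ n) = fps_const a * fps_X"
proof (rule fps_ext)
  fix n
  let ?E = "Abs_fps (\<lambda>n. of_nat n * a ^ n)"
  have 1: "((1 - fps_const a * fps_X) * ?E) $ k = (if k = 0 then 0 else a ^ k)" for k
    unfolding fps_one_minus_cX_mult_nth by (cases k) (simp_all add: algebra_simps)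
  have "((1 - fps_const a * fps_X) * ((1 - fps_const a * fps_X) * ?E)) $ n = (fps_const a * fps_X) $ n"
    by (subst fps_one_minus_cX_mult_nth, subst (1 2) 1) (cases n; auto simp: power_eq_if)
  then show "((1 - fps_const a * fps_X)\<^sup>2 * ?E) $ n = (fps_const a * fps_X) $ n"
    by (simp only: power2_eq_square mult.assoc)
qed

text \<open>
  With \<open>v = (1 + a b x\<^sup>2) / x\<close> one has \<open>(1 - a x) (1 - b x) = x (v - (a + b))\<close>, and
  \<open>a x (1 - b x)\<^sup>2 + b x (1 - a x)\<^sup>2 = x\<^sup>2 ((a + b) v - 4 a b)\<close>.
\<close>

lemma paired_geometric_reciprocal:
  fixes a b :: complex
  defines "F \<equiv> Abs_fps (\<lambda>n. of_nat n * (a ^ n + b ^ n))"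
  shows "fps_of_poly (reciprocal_subst (a * b) 2 ([:- (a + b), 1:]\<^sup>2)) * F
       = fps_of_poly (reciprocal_subst (a * b) 2 [:- 4 * (a * b), a + b:])"
    (is "?L = fps_of_poly ?R")
proof -
  let ?E = "\<lambda>x :: complex. Abs_fps (\<lambda>n. of_nat n * x ^ n)"
  let ?l = "\<lambda>x :: complex. 1 - fps_const x * fps_X"
  have F: "F = ?E a + ?E b" unfolding F_def by (rule fps_ext) (simp add: ring_distribs)
  have H: "reciprocal_subst (a * b) 2 ([:- (a + b), 1:]\<^sup>2) = ([:1, -a:] * [:1, -b:])\<^sup>2"
  proof (rule poly_eqI_nonzero)
    fix z :: complex assume z: "z \<noteq> 0"
    have "degree ([:- (a + b), 1:]\<^sup>2) \<le> 2" using degree_power_le[of "[:- (a + b), 1:]" 2] by simp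
    moreover have "poly ([:- (a + b), 1:]\<^sup>2) v = (v - (a + b))\<^sup>2" for v
      by (simp add: algebra_simps)
    ultimately have "poly (reciprocal_subst (a * b) 2 ([:- (a + b), 1:]\<^sup>2)) z = z\<^sup>2 * ((1
        + a * b * z\<^sup>2) / z - (a + b))\<^sup>2"
      by (simp only: poly_reciprocal_subst[OF z])
    also have "\<dots> = (z * ((1 + a * b * z\<^sup>2) / z - (a + b)))\<^sup>2" by (rule power_mult_distrib[symmetric])
    also have "z * ((1 + a * b * z\<^sup>2) / z - (a + b)) = (1 - a * z) * (1 - b * z)"
      using z by (simp add: field_simps power2_eq_square)
    finally have *: "poly (reciprocal_subst (a * b) 2 ([:- (a + b), 1:]\<^sup>2)) z = ((1 - a * z) * (1
        - b * z))\<^sup>2" .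
    have "poly [:1, -x:] z = 1 - x * z" for x by (simp add: mult.commute)
    then show "poly (reciprocal_subst (a * b) 2 ([:- (a + b), 1:]\<^sup>2)) z
        = poly (([:1, -a:] * [:1, -b:])\<^sup>2) z"
      unfolding * by (simp only: poly_power poly_mult)
  qed
  have lin: "fps_of_poly [:1, -x:] = ?l x" "fps_of_poly [:0, x:] = fps_const x * fps_X" for x :: complex
    by (simp_all add: fps_of_poly_linear)
  have "?L = (?l a * ?l b)\<^sup>2 * F"
    by (simp only: H fps_of_poly_power fps_of_poly_mult lin)
  also have "\<dots> = (?l b)\<^sup>2 * ((?l a)\<^sup>2 * ?E a) + (?l a)\<^sup>2 * ((?l b)\<^sup>2 * ?E b)"
    by (simp only: F power_mult_distrib distrib_left mult_ac)
  also have "\<dots> = (?l b)\<^sup>2 * (fps_const a * fps_X) + (?l a)\<^sup>2 * (fps_const b * fps_X)"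
    unfolding fps_nat_times_geometric ..
  also have "\<dots> = fps_of_poly ([:1, -b:]\<^sup>2 * [:0, a:] + [:1, -a:]\<^sup>2 * [:0, b:])"
    by (simp only: fps_of_poly_mult fps_of_poly_power fps_of_poly_add lin)
  also have "[:1, -b:]\<^sup>2 * [:0, a:] + [:1, -a:]\<^sup>2 * [:0, b:] = ?R"
  proof (rule poly_eqI_nonzero)
    fix z :: complex assume z: "z \<noteq> 0"
    have "degree [:- 4 * (a * b), a + b:] \<le> 2" by simp
    then show "poly ([:1, -b:]\<^sup>2 * [:0, a:] + [:1, -a:]\<^sup>2 * [:0, b:]) z = poly ?R z"
      unfolding poly_reciprocal_subst[OF z \<open>degree [:- 4 * (a * b), a + b:] \<le> 2\<close>] using z
          by (simp add: field_simps power2_eq_square)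
  qed
  finally show ?thesis .
qed

text \<open>
  The power series \<open>F\<close> is a rational function of \<open>(1 + c x\<^sup>2) / x\<close>, expressed without leaving the
  ring of power series, where that argument does not exist.
\<close>

definition reciprocal_ratfun :: "complex \<Rightarrow> complex fps \<Rightarrow> bool" where
  "reciprocal_ratfun c F \<longleftrightarrow> (\<exists>N g h. degree g \<le> N \<and> degree h \<le> N \<and> h \<noteq> 0 \<and>
     fps_of_poly (reciprocal_subst c N h) * F = fps_of_poly (reciprocal_subst c N g))"

lemma reciprocal_ratfun_0: "reciprocal_ratfun c 0"
  unfolding reciprocal_ratfun_def
  by (rule exI[of _ 0], rule exI[of _ 0], rule exI[of _ 1]) (simp add: reciprocal_subst_def)

lemma reciprocal_ratfun_cmult:
  assumes "reciprocal_ratfun c F" shows "reciprocal_ratfun c (fps_const k * F)"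
proof -
  obtain N g h where *: "degree g \<le> N" "degree h \<le> N" "h \<noteq> 0"
     "fps_of_poly (reciprocal_subst c N h) * F = fps_of_poly (reciprocal_subst c N g)"
    using assms unfolding reciprocal_ratfun_def by blast
  have "reciprocal_subst c N (Polynomial.smult k g) = Polynomial.smult k (reciprocal_subst c N g)"
    unfolding reciprocal_subst_def by (rule poly_eqI) (simp add: coeff_sum sum_distrib_left mult.assoc)
  then have "fps_of_poly (reciprocal_subst c N h) * (fps_const k * F)
      = fps_of_poly (reciprocal_subst c N (Polynomial.smult k g))"
    by (simp add: fps_of_poly_smult *(4)[symmetric] mult_ac)
  moreover have "degree (Polynomial.smult k g) \<le> N" using *(1) degree_smult_le[of k g] by simp
  ultimately show ?thesis using *(2,3) unfolding reciprocal_ratfun_def by blast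
qed

lemma reciprocal_ratfun_add:
  assumes "reciprocal_ratfun c F" "reciprocal_ratfun c G" shows "reciprocal_ratfun c (F + G)"
proof -
  obtain M f h where F: "degree f \<le> M" "degree h \<le> M" "h \<noteq> 0"
     "fps_of_poly (reciprocal_subst c M h) * F = fps_of_poly (reciprocal_subst c M f)"
    using assms(1) unfolding reciprocal_ratfun_def by blast
  obtain N g k where G: "degree g \<le> N" "degree k \<le> N" "k \<noteq> 0"
     "fps_of_poly (reciprocal_subst c N k) * G = fps_of_poly (reciprocal_subst c N g)"
    using assms(2) unfolding reciprocal_ratfun_def by blast
  let ?r = "\<lambda>N p. fps_of_poly (reciprocal_subst c N p)"
  have "?r (M + N) (h * k) * (F + G) = ?r N k * (?r M h * F) + ?r M h * (?r N k * G)"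
    by (simp add: reciprocal_subst_mult[OF F(2) G(2)] fps_of_poly_mult ring_distribs mult_ac)
  also have "\<dots> = ?r (M + N) (f * k + h * g)"
    unfolding F(4) G(4) reciprocal_subst_add
    unfolding reciprocal_subst_mult[OF F(1) G(2)] reciprocal_subst_mult[OF F(2) G(1)]
    by (simp add: fps_of_poly_mult fps_of_poly_add mult_ac)
  finally have "?r (M + N) (h * k) * (F + G) = ?r (M + N) (f * k + h * g)" .
  moreover have "degree (f * k + h * g) \<le> M + N"
    using degree_mult_le[of f k] degree_mult_le[of h g] F(1,2) G(1,2) by (intro degree_add_le) auto
  moreover have "degree (h * k) \<le> M + N" using degree_mult_le[of h k] F(2) G(2) by simp
  moreover have "h * k \<noteq> 0" using F(3) G(3) by simp
  ultimately show ?thesis unfolding reciprocal_ratfun_def by blast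
qed

lemma reciprocal_ratfun_exponential_sum:
  fixes a b k :: "'i \<Rightarrow> complex"
  assumes "finite I" "\<And>i. i \<in> I \<Longrightarrow> a i * b i = c"
  shows "reciprocal_ratfun c (\<Sum>i\<in>I. fps_const (k i) * Abs_fps (\<lambda>n. of_nat n * (a i ^ n + b i ^ n)))"
  using assms
proof (induction I rule: finite_induct)
  case empty
  then show ?case by (simp add: reciprocal_ratfun_0)
next
  case (insert i I)
  have ab: "a i * b i = c" using insert.prems by simp
  have "reciprocal_ratfun c (Abs_fps (\<lambda>n. of_nat n * (a i ^ n + b i ^ n)))"
    unfolding reciprocal_ratfun_def
  proof (intro exI conjI)
    show "fps_of_poly (reciprocal_subst c 2 ([:- (a i + b i), 1:]\<^sup>2)) * Abs_fps (\<lambda>n. of_nat n * (a i ^ n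
        + b i ^ n))
       = fps_of_poly (reciprocal_subst c 2 [:- 4 * c, a i + b i:])"
      by (rule paired_geometric_reciprocal[of "a i" "b i", unfolded ab])
    show "degree ([:- (a i + b i), 1:]\<^sup>2) \<le> 2" using degree_power_le[of "[:- (a i + b i), 1:]" 2] by simp
  qed simp_all
  then show ?case
    using insert by (simp add: reciprocal_ratfun_add reciprocal_ratfun_cmult)
qed

section \<open>Descent to integer coefficients\<close>

text \<open>
  The number \<open>z\<close> is part of a basis of \<open>\<complex>\<close> over \<open>\<rat>\<close>, so the \<open>\<rat>\<close>-linear map sending \<open>z\<close> to \<open>1\<close> can be
  extended to \<open>\<complex>\<close>.
\<close>

lemma rational_functional:
  assumes "z \<noteq> 0"
  obtains \<phi> :: "complex \<Rightarrow> rat" where "\<phi> z \<noteq> 0" "\<And>x y. \<phi> (x + y) = \<phi> x + \<phi> y"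
    "\<And>a x. \<phi> (of_int a * x) = of_int a * \<phi> x"
proof -
  interpret vector_space_pair "\<lambda>(r :: rat) (x :: complex). of_rat r * x" "\<lambda>(r :: rat) (x :: rat). r * x"
    by unfold_locales (simp_all add: algebra_simps of_rat_add of_rat_mult)
  have "vs1.independent {z}" using assms by (simp add: vs1.independent_insert vs1.independent_empty)
  then obtain \<phi> where \<phi>: "Vector_Spaces.linear (\<lambda>(r :: rat) (x :: complex). of_rat r * x) (\<lambda>(r :: rat)
      (x :: rat). r * x) \<phi>"
    "\<forall>x\<in>{z}. \<phi> x = 1"
    using linear_independent_extend[of "{z}" "\<lambda>_. 1"] by blast
  interpret \<phi>: Vector_Spaces.linear "\<lambda>(r :: rat) (x :: complex). of_rat r * x" "\<lambda>(r :: rat)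
      (x :: rat). r * x" \<phi>
    by (rule \<phi>(1))
  show ?thesis
  proof (rule that)
    show "\<phi> z \<noteq> 0" using \<phi>(2) by simp
    show "\<phi> (x + y) = \<phi> x + \<phi> y" for x y by (rule \<phi>.add)
    show "\<phi> (of_int a * x) = of_int a * \<phi> x" for a x using \<phi>.scale[of "of_int a" x] by simp
  qed
qed

lemma common_denominator:
  fixes X :: "rat set"
  assumes "finite X"
  shows "\<exists>D::int. D \<noteq> 0 \<and> (\<forall>x\<in>X. of_int D * x \<in> \<int>)"
  using assms
proof (induction X rule: finite_induct)
  case empty
  then show ?case by (intro exI[of _ 1]) simp
next
  case (insert x X)
  then obtain D :: int where D: "D \<noteq> 0" "\<forall>x\<in>X. of_int D * x \<in> \<int>" by blast
  obtain a b where x: "x = of_int a / of_int b" "b \<noteq> 0"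
    by (metis Fract_of_int_quotient Rat_cases less_irrefl)
  have "of_int (D * b) * x = of_int (D * a)" using x by simp
  then have "of_int (D * b) * x \<in> \<int>" by (metis Ints_of_int)
  moreover have "of_int (D * b) * y \<in> \<int>" if "y \<in> X" for y
  proof -
    have "of_int (D * b) * y = of_int b * (of_int D * y)" by simp
    then show ?thesis using D(2) that by (metis Ints_mult Ints_of_int)
  qed
  ultimately show ?case using D(1) x(2) by (intro exI[of _ "D * b"]) auto
qed

definition fps_of_int :: "int fps \<Rightarrow> complex fps" where
  "fps_of_int F = Abs_fps (\<lambda>n. of_int (F $ n))"

lemma fps_of_int_nth: "fps_of_int F $ n = of_int (F $ n)"
  by (simp add: fps_of_int_def)

lemma map_poly_of_int_mult:
  "map_poly of_int (p * q) = (map_poly of_int p * map_poly of_int q :: complex poly)"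
  by (rule poly_eqI) (simp add: coeff_map_poly coeff_mult)

lemma map_poly_of_int_add:
  "map_poly of_int (p + q) = (map_poly of_int p + map_poly of_int q :: complex poly)"
  by (rule poly_eqI) (simp add: coeff_map_poly)

lemma map_poly_of_int_smult:
  "map_poly of_int (Polynomial.smult k p) = (Polynomial.smult (of_int k)
      (map_poly of_int p) :: complex poly)"
  by (rule poly_eqI) (simp add: coeff_map_poly)

lemma map_poly_of_int_power:
  "map_poly of_int (p ^ n) = (map_poly of_int p ^ n :: complex poly)"
  by (induction n) (simp_all add: map_poly_of_int_mult map_poly_pCons one_pCons)

lemma map_poly_of_int_reciprocal_subst:
  "map_poly of_int (reciprocal_subst c N h) = reciprocal_subst (of_int c :: complex) N (map_poly of_int h)"
proof -
  have base: "map_poly of_int ([:1, 0, c:] ^ i * [:0, 1:] ^ j)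
      = ([:1, 0, of_int c:] ^ i * [:0, 1:] ^ j :: complex poly)" for i j
    by (simp add: map_poly_of_int_mult map_poly_of_int_power map_poly_pCons)
  show ?thesis
    unfolding reciprocal_subst_def base[symmetric]
    by (rule poly_eqI) (simp add: coeff_map_poly coeff_sum)
qed

text \<open>
  For fixed \<open>N\<close>, \<open>c\<close> and \<open>F\<close>, the equation between the coefficients of \<open>x\<^sup>n\<close> is linear in the coefficients of
  \<open>g\<close> and \<open>h\<close>, with integer coefficients. It survives a \<open>\<rat>\<close>-linear functional \<open>\<phi>\<close> applied to all
  coefficients of \<open>g\<close> and \<open>h\<close>, and \<open>\<phi>\<close> can be chosen not to annihilate \<open>h\<close>.
\<close>

lemma reciprocal_ratfun_integral:
  assumes "reciprocal_ratfun (of_int c) (fps_of_int F)"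
  shows "\<exists>N (g :: int poly) (h :: int poly). degree g \<le> N \<and> degree h \<le> N \<and> h \<noteq> 0 \<and>
    fps_of_poly (reciprocal_subst c N h) * F = fps_of_poly (reciprocal_subst c N g)"
proof -
  obtain N g h where deg: "degree g \<le> N" "degree h \<le> N" and "h \<noteq> 0"
    and eq: "fps_of_poly (reciprocal_subst (of_int c) N h) * fps_of_int F
        = fps_of_poly (reciprocal_subst (of_int c) N g)"
    using assms unfolding reciprocal_ratfun_def by blast
  obtain j where j: "coeff h j \<noteq> 0" using \<open>h \<noteq> 0\<close> by (auto simp: poly_eq_iff)
  obtain \<phi> :: "complex \<Rightarrow> rat" where \<phi>j: "\<phi> (coeff h j) \<noteq> 0"
    and \<phi>_add: "\<And>x y. \<phi> (x + y) = \<phi> x + \<phi> y" and \<phi>_scale: "\<And>a x. \<phi> (of_int a * x) = of_int a * \<phi> x"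
    using rational_functional[OF j] by blast
  have \<phi>0: "\<phi> 0 = 0" using \<phi>_scale[of 0 0] by simp
  have \<phi>_sum: "\<phi> (sum f A) = (\<Sum>i\<in>A. \<phi> (f i))" for f and A :: "nat set"
    by (induction A rule: infinite_finite_induct) (auto simp: \<phi>_add \<phi>0)
  have "finite (\<phi> ` (coeff g ` {..N} \<union> coeff h ` {..N}))" by simp
  then obtain D :: int where D: "D \<noteq> 0"
    "\<forall>x\<in>\<phi> ` (coeff g ` {..N} \<union> coeff h ` {..N}). of_int D * x \<in> \<int>"
    using common_denominator by meson
  \<comment> \<open>on the coefficients of \<open>g\<close> and \<open>h\<close> the rounding has no effect\<close>
  define \<psi> :: "complex \<Rightarrow> int" where "\<psi> x = \<lfloor>of_int D * \<phi> x\<rfloor>" for x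
  have \<psi>0: "\<psi> 0 = 0" by (simp add: \<psi>_def \<phi>0)
  define g' where "g' = map_poly \<psi> g"
  define h' where "h' = map_poly \<psi> h"
  have coeff': "coeff g' i = \<psi> (coeff g i)" "coeff h' i = \<psi> (coeff h i)" for i
    by (simp_all add: g'_def h'_def coeff_map_poly \<psi>0)
  have \<psi>: "of_int (coeff g' i) = of_int D * \<phi> (coeff g i)" "of_int (coeff h' i) = of_int D * \<phi> (coeff h i)"
    if "i \<le> N" for i
    using D(2) that unfolding coeff' \<psi>_def by (simp_all add: of_int_floor)
  have "degree g' \<le> N" "degree h' \<le> N"
    using deg by (auto intro!: degree_le simp: coeff' \<psi>0 coeff_eq_0)
  moreover have "h' \<noteq> 0"
  proof -
    have "j \<le> N" using deg(2) le_degree[OF j] by simp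
    then have "(of_int (coeff h' j) :: rat) \<noteq> 0" using \<psi>(2) D(1) \<phi>j by simp
    then show ?thesis by auto
  qed
  moreover have "fps_of_poly (reciprocal_subst c N h') * F = fps_of_poly (reciprocal_subst c N g')"
  proof (rule fps_ext)
    fix n
    \<comment> \<open>\<open>u\<close> and \<open>v\<close> are the integer coefficients of the linear equation\<close>
    define B :: "nat \<Rightarrow> int poly" where "B i = [:1, 0, c:] ^ i * [:0, 1:] ^ (N - i)" for i
    have B: "([:1, 0, of_int c:] ^ i * [:0, 1:] ^ (N - i) :: complex poly) = map_poly of_int (B i)" for i
      by (simp add: B_def map_poly_of_int_mult map_poly_of_int_power map_poly_pCons)
    define u where "u i = (fps_of_poly (B i) * F) $ n" for i
    define v where "v i = coeff (B i) n" for i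
    have lhs: "(fps_of_poly (reciprocal_subst c N p) * F) $ n = (\<Sum>i\<le>N. coeff p i * u i)"
      and rhs: "fps_of_poly (reciprocal_subst c N p) $ n = (\<Sum>i\<le>N. coeff p i * v i)" for p
      by (simp_all add: reciprocal_subst_def B_def[symmetric] fps_of_poly_sum fps_of_poly_smult
          sum_distrib_right fps_sum_nth mult.assoc u_def v_def)
    have u: "(fps_of_poly (map_poly of_int (B i)) * fps_of_int F) $ n = of_int (u i)" for i
      by (simp add: u_def fps_mult_nth fps_of_int_nth coeff_map_poly)
    have "(\<Sum>i\<le>N. of_int (u i) * coeff h i)
        = (fps_of_poly (reciprocal_subst (of_int c) N h) * fps_of_int F) $ n"
      by (simp add: reciprocal_subst_def B fps_of_poly_sum fps_of_poly_smult sum_distrib_right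
          fps_sum_nth mult.assoc u) (simp add: mult.commute)
    also have "\<dots> = (\<Sum>i\<le>N. of_int (v i) * coeff g i)"
      unfolding eq unfolding reciprocal_subst_def B
          by (simp add: coeff_sum coeff_map_poly v_def mult.commute)
    finally have "\<phi> (\<Sum>i\<le>N. of_int (u i) * coeff h i) = \<phi> (\<Sum>i\<le>N. of_int (v i) * coeff g i)" by simp
    then have "(\<Sum>i\<le>N. of_int D * (of_int (u i) * \<phi> (coeff h i)))
        = (\<Sum>i\<le>N. of_int D * (of_int (v i) * \<phi> (coeff g i)))"
      by (simp add: \<phi>_sum \<phi>_scale flip: sum_distrib_left)
    then have "(\<Sum>i\<le>N. of_int (coeff h' i) * of_int (u i))
        = (\<Sum>i\<le>N. of_int (coeff g' i) * (of_int (v i) :: rat))"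
      by (simp add: \<psi> mult_ac)
    then have "(of_int (\<Sum>i\<le>N. coeff h' i * u i) :: rat) = of_int (\<Sum>i\<le>N. coeff g' i * v i)" by simp
    then show "(fps_of_poly (reciprocal_subst c N h') * F) $ n = fps_of_poly (reciprocal_subst c N g') $ n"
      unfolding lhs rhs by (simp only: of_int_eq_iff)
  qed
  ultimately show ?thesis by blast
qed

lemma map_poly_of_int_nonzero: "map_poly of_int p = (0 :: complex poly) \<longleftrightarrow> p = 0"
  by (auto simp: poly_eq_iff coeff_map_poly)

lemma degree_map_poly_of_int_le: "degree (map_poly of_int p :: complex poly) \<le> degree p"
  by (rule degree_le) (simp add: coeff_map_poly coeff_eq_0)

lemma poly_map_poly_of_int_pcompose:
  "poly (map_poly of_int (pcompose p [:0, k:])) x = poly (map_poly of_int p) (of_int k * x :: complex)"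
  by (induction p) (simp_all add: pcompose_pCons map_poly_pCons map_poly_of_int_smult map_poly_of_int_add)

section \<open>The generating function\<close>

lemma dihedral_tau_gf_reciprocal:
  assumes "t \<ge> 1" "\<forall>i\<in>{1..s}. 0 < \<beta> i" "dihedral_P s t \<beta> \<gamma> \<noteq> 0"
  shows "reciprocal_ratfun (of_int ((dihedral_eta s t \<beta> \<gamma>)\<^sup>2)) (fps_of_int (dihedral_tau_gf s t \<beta> \<gamma>))"
proof -
  obtain I :: "nat set set" and c \<mu> \<nu> where I: "finite I"
    and \<mu>\<nu>: "\<And>S. S \<in> I \<Longrightarrow> \<mu> S * \<nu> S = of_int ((dihedral_eta s t \<beta> \<gamma>)\<^sup>2)"
    and \<tau>: "\<And>n. n > 0 \<Longrightarrow> (of_nat (dihedral_tau s t \<beta> \<gamma> n) :: complex) = of_nat n * (\<Sum>S\<in>I. c S * (\<mu> S ^ n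
        + \<nu> S ^ n))"
    using dihedral_tau_exponential_sum[OF assms] by blast
  have "fps_of_int (dihedral_tau_gf s t \<beta> \<gamma>)
      = (\<Sum>S\<in>I. fps_const (c S) * Abs_fps (\<lambda>n. of_nat n * (\<mu> S ^ n + \<nu> S ^ n)))"
    by (rule fps_ext)
      (auto simp: fps_of_int_nth dihedral_tau_gf_def fps_sum_nth \<tau> sum_distrib_left mult.left_commute)
  then show ?thesis using reciprocal_ratfun_exponential_sum[OF I \<mu>\<nu>] by simp
qed

lemma complex_sum_with_inverse:
  fixes c v :: complex
  assumes "c \<noteq> 0"
  obtains x where "x \<noteq> 0" "(1 + c * x\<^sup>2) / x = v"
proof -
  \<comment> \<open>a solution of \<open>c x\<^sup>2 - v x + 1 = 0\<close>\<close>
  define x where "x = (v + csqrt (v\<^sup>2 - 4 * c)) / (2 * c)"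
  have "(2 * c * x - v)\<^sup>2 = v\<^sup>2 - 4 * c" using assms by (simp add: x_def)
  then have "4 * c * (1 + c * x\<^sup>2 - v * x) = 0" by (simp add: power2_eq_square algebra_simps)
  then have eq: "1 + c * x\<^sup>2 = v * x" using assms by simp
  then have "x \<noteq> 0" by auto
  then show ?thesis using that[of x] eq by simp
qed

text \<open>
  Some \<open>v\<close> is not a root of \<open>h\<close>, and over \<open>\<complex>\<close> it has the form \<open>(1 + c x\<^sup>2) / x\<close>.
\<close>

lemma reciprocal_subst_nonzero:
  assumes "c \<noteq> 0" "degree h \<le> N" "h \<noteq> 0"
  shows "reciprocal_subst (c :: complex) N h \<noteq> 0"
proof
  assume zero: "reciprocal_subst c N h = 0"
  obtain v where v: "poly h v \<noteq> 0" using assms(3) poly_all_0_iff_0 by blast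
  obtain x where "x \<noteq> 0" "(1 + c * x\<^sup>2) / x = v" using complex_sum_with_inverse[OF assms(1)] by blast
  then show False using poly_reciprocal_subst[of x h N c] assms(2) zero v by simp
qed

text \<open>
  For \<open>n \<ge> 2\<close> the product over the roots of unity other than \<open>1\<close> contains a zero factor; for \<open>n = 1\<close> it is
  empty.
\<close>

lemma dihedral_tau_gf_P_zero:
  assumes "dihedral_P s t \<beta> \<gamma> = 0"
  shows "dihedral_tau_gf s t \<beta> \<gamma> = fps_of_poly [:0, int t:]"
proof (rule fps_ext)
  fix n
  show "dihedral_tau_gf s t \<beta> \<gamma> $ n = fps_of_poly [:0, int t:] $ n"
  proof (cases "n = 0")
    case False
    then interpret dihedral_graph s t \<beta> \<gamma> n by unfold_locales simp
    have "of_nat n * (of_nat (dihedral_tau s t \<beta> \<gamma> n) :: complex) = of_nat (if n = 1 then t else 0)"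
      using dihedral_tau_eigenvalues False by (simp add: assms)
    then have "dihedral_tau s t \<beta> \<gamma> n = (if n = 1 then t else 0)"
      using False by (auto split: if_splits)
    then show ?thesis using False by (auto simp: dihedral_tau_gf_def coeff_pCons split: nat.split)
  qed (simp add: dihedral_tau_gf_def)
qed

theorem theorem6p1:
  fixes s t :: nat and \<beta> \<gamma> :: "nat \<Rightarrow> int"
  assumes "t \<ge> 1"
    and "\<forall>i\<in>{1..s}. 0 < \<beta> i" and "strict_mono_on {1..s} \<beta>"
    and "\<forall>j\<in>{1..t}. 0 \<le> \<gamma> j" and "strict_mono_on {1..t} \<gamma>"
  shows "\<exists>p q :: int poly.
    fps_is_ratfun (dihedral_tau_gf s t \<beta> \<gamma>) p q \<and>
    (dihedral_P s t \<beta> \<gamma> \<noteq> 0 \<longrightarrow>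
      (let \<eta> = complex_of_int (dihedral_eta s t \<beta> \<gamma>) in
        (\<forall>x. x \<noteq> 0 \<and> ratfun_defined q (x / \<eta>) \<and> ratfun_defined q (1 / (\<eta> * x)) \<longrightarrow>
          ratfun_eval p q (x / \<eta>) = ratfun_eval p q (1 / (\<eta> * x))) \<and>
        (\<exists>g h :: int poly. h \<noteq> 0 \<and>
          (\<forall>x. x \<noteq> 0 \<and> ratfun_defined q x \<and>
               ratfun_defined h ((\<eta> * x + 1 / (\<eta> * x)) / 2) \<longrightarrow>
            ratfun_eval p q x = ratfun_eval g h ((\<eta> * x + 1 / (\<eta> * x)) / 2)))))"
proof (cases "dihedral_P s t \<beta> \<gamma> = 0")
  case True
  then have "fps_is_ratfun (dihedral_tau_gf s t \<beta> \<gamma>) [:0, int t:] 1"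
    by (simp add: fps_is_ratfun_def dihedral_tau_gf_P_zero)
  then show ?thesis using True by blast
next
  case False
  define e where "e = dihedral_eta s t \<beta> \<gamma>"
  define \<eta> where "\<eta> = complex_of_int e"
  have "\<eta> \<noteq> 0" using dihedral_P_quotient[OF assms(1,2) False] by (auto simp: \<eta>_def e_def)
  then have "e \<noteq> 0" by (simp add: \<eta>_def)
  obtain N and g h :: "int poly" where deg: "degree g \<le> N" "degree h \<le> N" and "h \<noteq> 0"
    and gf: "fps_of_poly (reciprocal_subst (e\<^sup>2) N h) * dihedral_tau_gf s t \<beta> \<gamma>
           = fps_of_poly (reciprocal_subst (e\<^sup>2) N g)"
    using reciprocal_ratfun_integral[OF dihedral_tau_gf_reciprocal[OF assms(1,2) False]]
    unfolding e_def by blast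
  define p where "p = reciprocal_subst (e\<^sup>2) N g"
  define q where "q = reciprocal_subst (e\<^sup>2) N h"
  \<comment> \<open>\<open>(1 + \<eta>\<^sup>2 x\<^sup>2) / x = 2 \<eta> u\<close> for the variable \<open>u\<close> of the claim\<close>
  define G where "G = pcompose g [:0, 2 * e:]"
  define H where "H = pcompose h [:0, 2 * e:]"
  let ?u = "\<lambda>x. (\<eta> * x + 1 / (\<eta> * x)) / 2"
  have "q \<noteq> 0"
  proof -
    have "map_poly of_int q = reciprocal_subst (of_int (e\<^sup>2) :: complex) N (map_poly of_int h)"
      by (simp only: q_def map_poly_of_int_reciprocal_subst)
    moreover have "reciprocal_subst (of_int (e\<^sup>2) :: complex) N (map_poly of_int h) \<noteq> 0"
    proof (rule reciprocal_subst_nonzero)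
      show "degree (map_poly of_int h :: complex poly) \<le> N"
        using degree_map_poly_of_int_le deg(2) by (rule order_trans)
    qed (use \<open>h \<noteq> 0\<close> \<open>e \<noteq> 0\<close> in \<open>simp_all add: map_poly_of_int_nonzero\<close>)
    ultimately show ?thesis by auto
  qed
  have "H \<noteq> 0" using \<open>h \<noteq> 0\<close> \<open>e \<noteq> 0\<close> by (auto simp: H_def dest!: pcompose_eq_0)
  have subst: "poly (map_poly of_int (reciprocal_subst (e\<^sup>2) N f)) x
      = x ^ N * poly (map_poly of_int (pcompose f [:0, 2 * e:])) (?u x)"
    if x: "x \<noteq> 0" and f: "degree f \<le> N" for f :: "int poly" and x :: complex
  proof -
    have "degree (map_poly of_int f :: complex poly) \<le> N"
      using degree_map_poly_of_int_le f by (rule order_trans)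
    from poly_reciprocal_subst[OF x this, of "of_int (e\<^sup>2)"]
    have "poly (map_poly of_int (reciprocal_subst (e\<^sup>2) N f)) x
      = x ^ N * poly (map_poly of_int f) ((1 + \<eta>\<^sup>2 * x\<^sup>2) / x)"
      by (simp add: map_poly_of_int_reciprocal_subst \<eta>_def)
    also have "(1 + \<eta>\<^sup>2 * x\<^sup>2) / x = of_int (2 * e) * ?u x"
      using x \<open>\<eta> \<noteq> 0\<close> by (simp add: \<eta>_def[symmetric] field_simps power2_eq_square)
    finally show ?thesis by (simp only: poly_map_poly_of_int_pcompose)
  qed
  have eval: "ratfun_eval p q x = ratfun_eval G H (?u x)" if "x \<noteq> 0" for x
    using that deg by (simp add: ratfun_eval_def p_def q_def G_def H_def subst)
  have "fps_is_ratfun (dihedral_tau_gf s t \<beta> \<gamma>) p q"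
    using gf \<open>q \<noteq> 0\<close> by (simp add: fps_is_ratfun_def p_def q_def)
  moreover have "\<forall>x. x \<noteq> 0 \<and> ratfun_defined q (x / \<eta>) \<and> ratfun_defined q (1 / (\<eta> * x)) \<longrightarrow>
      ratfun_eval p q (x / \<eta>) = ratfun_eval p q (1 / (\<eta> * x))"
  proof (intro allI impI)
    fix x
    assume "x \<noteq> 0 \<and> ratfun_defined q (x / \<eta>) \<and> ratfun_defined q (1 / (\<eta> * x))"
    then have nz: "x / \<eta> \<noteq> 0" "1 / (\<eta> * x) \<noteq> 0" and u: "?u (x / \<eta>) = ?u (1 / (\<eta> * x))"
      using \<open>\<eta> \<noteq> 0\<close> by auto
    show "ratfun_eval p q (x / \<eta>) = ratfun_eval p q (1 / (\<eta> * x))"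
      unfolding eval[OF nz(1)] eval[OF nz(2)] u ..
  qed
  moreover have "\<exists>g h :: int poly. h \<noteq> 0 \<and>
          (\<forall>x. x \<noteq> 0 \<and> ratfun_defined q x \<and> ratfun_defined h (?u x) \<longrightarrow>
            ratfun_eval p q x = ratfun_eval g h (?u x))"
    using \<open>H \<noteq> 0\<close> eval by (intro exI[of _ G] exI[of _ H]) simp
  ultimately show ?thesis
    unfolding Let_def e_def[symmetric] \<eta>_def[symmetric]
    by - (rule exI[of _ p], rule exI[of _ q], intro conjI impI)
qed

end
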